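(* If $G$ is a $K_4$-minor-free graph of maximum degree at most $3$, then $\chi^{[\sharp 2]}(G)\le 4$. Furthermore, this bound is tight in the following sense: there exists a bipartite $K_4$-minor-free graph $G_1$ of maximum degree at most $3$ and girth at least $6$ with $\chi^{[\sharp 2]}(G_1)=4$, and there exists an outerplanar graph $G_2$ of maximum degree at most $3$ with $\chi^{[\sharp 2]}(G_2)=4$.
   Context: Graphs are finite and simple. An exact square coloring of a graph $G$ is an assignment of colors to the vertices of $G$ such that any two vertices at distance exactly $2$ in $G$ receive distinct colors; $\chi^{[\sharp 2]}(G)$ is the smallest number of colors in such a coloring. *)

theory Defs
  imports "HOL-Analysis.Analysis" "Graph_Theory.Graph_Theory"
begin

text \<open>
  A finite simple graph is a \<^term>\<open>G :: 'a pair_pre_digraph\<close> with \<^prop>\<open>pair_graph G\<close>: its arc set is a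
  finite, irreflexive and symmetric relation, so an undirected edge between \<open>u\<close> and \<open>v\<close> is the pair
  of arcs \<open>(u, v)\<close>, \<open>(v, u)\<close>. The definitions below are meant for such \<open>G\<close>.
\<close>

text \<open>By symmetry the out-degree of a vertex is its number of neighbours; the value is 0 on the
  empty graph.\<close>

definition max_degree :: "'a pair_pre_digraph \<Rightarrow> nat" where
  "max_degree G = Max (insert 0 (out_degree (with_proj G) ` pverts G))"

text \<open>Infimum of the numbers of edges of walks; \<open>\<infinity>\<close> between different components.\<close>

definition graph_dist :: "'a pair_pre_digraph \<Rightarrow> 'a \<Rightarrow> 'a \<Rightarrow> ereal" where
  "graph_dist G u v = wf_digraph.\<mu> (with_proj G) (\<lambda>_. 1) u v"

definition exact_square_coloring :: "'a pair_pre_digraph \<Rightarrow> ('a \<Rightarrow> 'c) \<Rightarrow> bool" where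
  "exact_square_coloring G c \<longleftrightarrow>
     (\<forall>u\<in>pverts G. \<forall>v\<in>pverts G. graph_dist G u v = 2 \<longrightarrow> c u \<noteq> c v)"

definition exact_square_chromatic_number :: "'a pair_pre_digraph \<Rightarrow> nat" where
  "exact_square_chromatic_number G =
     (LEAST k. \<exists>c :: 'a \<Rightarrow> nat. exact_square_coloring G c \<and> card (c ` pverts G) = k)"

text \<open>\<open>H\<close> is a minor of \<open>G\<close> if \<open>G\<close> contains pairwise disjoint connected
  branch sets \<open>B x\<close>, one for each vertex \<open>x\<close> of \<open>H\<close>, with an edge of \<open>G\<close> between \<open>B x\<close> and \<open>B y\<close>
  for every edge \<open>xy\<close> of \<open>H\<close>. Nonemptiness of \<open>B x\<close> is part of
  \<open>Digraph_Component.connected\<close>.\<close>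

definition is_minor :: "'b pair_pre_digraph \<Rightarrow> 'a pair_pre_digraph \<Rightarrow> bool" where
  "is_minor H G \<longleftrightarrow>
     (\<exists>B :: 'b \<Rightarrow> 'a set.
        (\<forall>x\<in>pverts H. B x \<subseteq> pverts G \<and>
           Digraph_Component.connected (induce_subgraph (with_proj G) (B x))) \<and>
        (\<forall>x\<in>pverts H. \<forall>y\<in>pverts H. x \<noteq> y \<longrightarrow> B x \<inter> B y = {}) \<and>
        (\<forall>(x, y)\<in>parcs H. \<exists>u\<in>B x. \<exists>v\<in>B y. (u, v) \<in> parcs G))"

definition K4_minor_free :: "'a pair_pre_digraph \<Rightarrow> bool" where
  "K4_minor_free G \<longleftrightarrow>
     \<not> (\<exists>H :: nat pair_pre_digraph. complete_digraph 4 (with_proj H) \<and> is_minor H G)"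

definition bipartite :: "'a pair_pre_digraph \<Rightarrow> bool" where
  "bipartite G \<longleftrightarrow>
     (\<exists>A B. pverts G = A \<union> B \<and> A \<inter> B = {} \<and> parcs G \<subseteq> A \<times> B \<union> B \<times> A)"

text \<open>The lower bound on the length excludes the closed walks \<open>u, v, u\<close> along a single edge, which
  are directed cycles of length 2. The girth of a forest is \<open>\<infinity>\<close>.\<close>

definition girth :: "'a pair_pre_digraph \<Rightarrow> enat" where
  "girth G = (INF p \<in> {p. pre_digraph.cycle (with_proj G) p \<and> 3 \<le> length p}. enat (length p))"

text \<open>Crossing-free drawings in the plane: \<open>f\<close> places the vertices and \<open>\<gamma>\<close> draws the edges as simple
  arcs, the two orientations of an edge being drawn as the same arc. An arc meets the vertices only in
  its endpoints, and two different edges meet at most in a common endpoint.\<close>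

definition plane_drawing ::
  "'a pair_pre_digraph \<Rightarrow> ('a \<Rightarrow> complex) \<Rightarrow> ('a \<times> 'a \<Rightarrow> real \<Rightarrow> complex) \<Rightarrow> bool" where
  "plane_drawing G f \<gamma> \<longleftrightarrow>
     inj_on f (pverts G) \<and>
     (\<forall>(u, v)\<in>parcs G.
        Path_Connected.arc (\<gamma> (u, v)) \<and> pathstart (\<gamma> (u, v)) = f u \<and> pathfinish (\<gamma> (u, v)) = f v \<and>
        \<gamma> (v, u) = reversepath (\<gamma> (u, v)) \<and>
        path_image (\<gamma> (u, v)) \<inter> f ` pverts G = {f u, f v}) \<and>
     (\<forall>(u, v)\<in>parcs G. \<forall>(x, y)\<in>parcs G. {u, v} \<noteq> {x, y} \<longrightarrow>
        path_image (\<gamma> (u, v)) \<inter> path_image (\<gamma> (x, y)) \<subseteq> f ` ({u, v} \<inter> {x, y}))"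

definition drawing_image ::
  "'a pair_pre_digraph \<Rightarrow> ('a \<Rightarrow> complex) \<Rightarrow> ('a \<times> 'a \<Rightarrow> real \<Rightarrow> complex) \<Rightarrow> complex set" where
  "drawing_image G f \<gamma> = f ` pverts G \<union> (\<Union>e\<in>parcs G. path_image (\<gamma> e))"

text \<open>\<open>outside D\<close> is the union of the unbounded components of the complement of \<open>D\<close>; for the compact
  set \<open>D\<close> of a drawing this is the outer face.\<close>

definition outerplanar :: "'a pair_pre_digraph \<Rightarrow> bool" where
  "outerplanar G \<longleftrightarrow>
     (\<exists>f \<gamma>. plane_drawing G f \<gamma> \<and>
        f ` pverts G \<subseteq> frontier (outside (drawing_image G f \<gamma>)))"

end

theory Submission
  imports Defs
begin

text \<open>
  A colouring with four colours is found by induction, deleting a vertex of degree at most 1, two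
  adjacent vertices of degree 2, or a vertex of degree 2 on a triangle or a 4-cycle: every deleted
  vertex has at most three vertices at distance 2, and no constraint between the others is lost. If
  none of these is present, suppressing the vertices of degree 2 yields a simple cubic graph, which
  has a \<open>K\<^sub>4\<close> minor: take a longest path and a shortest chord \<open>x\<^sub>0 x\<^sub>i\<close> from its end; then
  \<open>{x\<^sub>0, \<dots>, x\<^bsub>i-2\<^esub>}\<close>, \<open>{x\<^bsub>i-1\<^esub>}\<close>, \<open>{x\<^sub>i}\<close> and the rest of the path are branch sets.

  The bipartite example consists of two vertices joined by three paths of length 3. The outerplanar
  example is a vertex with three copies of a gadget, each of which forces its attachment vertex to
  differ from the centre when only three colours are used.
\<close>

section \<open>Forcing a \<open>K\<^sub>4\<close> minor\<close>

text \<open>Distance exactly 2 in the subgraph induced on \<open>W\<close>. The relation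
  \<open>E\<close> stays fixed and only \<open>W\<close> shrinks, so deleting vertices needs no new
  graph.\<close>

definition conflict :: "'a rel \<Rightarrow> 'a set \<Rightarrow> 'a \<Rightarrow> 'a \<Rightarrow> bool" where
  "conflict E W u v \<longleftrightarrow>
     u \<in> W \<and> v \<in> W \<and> u \<noteq> v \<and> (u, v) \<notin> E \<and> (\<exists>w\<in>W. (u, w) \<in> E \<and> (w, v) \<in> E)"

definition conn :: "'a rel \<Rightarrow> 'a set \<Rightarrow> bool" where
  "conn E X \<longleftrightarrow> X \<noteq> {} \<and> (\<forall>x\<in>X. \<forall>y\<in>X. (x, y) \<in> (E \<inter> X \<times> X)\<^sup>*)"

definition linked :: "'a rel \<Rightarrow> 'a set \<Rightarrow> 'a set \<Rightarrow> bool" where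
  "linked E X Y \<longleftrightarrow> (\<exists>x\<in>X. \<exists>y\<in>Y. (x, y) \<in> E)"

text \<open>Only pairs with \<open>i < j\<close> are listed; for symmetric \<open>E\<close> this
  covers all pairs of branch sets. Indices from 4 on are unconstrained.\<close>

definition K4_model :: "'a rel \<Rightarrow> 'a set \<Rightarrow> (nat \<Rightarrow> 'a set) \<Rightarrow> bool" where
  "K4_model E V B \<longleftrightarrow>
     (\<forall>i<4. B i \<subseteq> V \<and> conn E (B i)) \<and>
     (\<forall>j<4. \<forall>i<j. B i \<inter> B j = {} \<and> linked E (B i) (B j))"

lemma conn_singleton: "conn E {x}"
  by (simp add: conn_def)

lemma conn_insert:
  assumes "sym E" "conn E X" "y \<in> X" "(x, y) \<in> E"
  shows "conn E (insert x X)"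
proof -
  let ?R = "(E \<inter> insert x X \<times> insert x X)\<^sup>*"
  have X: "(a, b) \<in> ?R" if "a \<in> X" "b \<in> X" for a b
  proof -
    have "(a, b) \<in> (E \<inter> X \<times> X)\<^sup>*" using assms(2) that by (auto simp: conn_def)
    moreover have "E \<inter> X \<times> X \<subseteq> E \<inter> insert x X \<times> insert x X" by auto
    ultimately show ?thesis using rtrancl_mono by blast
  qed
  have xy: "(x, y) \<in> ?R" "(y, x) \<in> ?R"
    using assms by (auto intro!: r_into_rtrancl dest: symD)
  show ?thesis
    unfolding conn_def using X xy assms(3) by (auto intro: rtrancl_trans)
qed

lemma conn_path:
  assumes "sym E"
  shows "xs \<noteq> [] \<Longrightarrow> successively (\<lambda>u v. (u, v) \<in> E) xs \<Longrightarrow> conn E (set xs)"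
proof (induction xs rule: induct_list012)
  case (3 x y zs)
  then have "conn E (insert x (set (y # zs)))"
    by (intro conn_insert[OF assms, of _ y]) auto
  then show ?case by simp
qed (auto simp: conn_singleton)

text \<open>Rerouting a longest path \<open>q @ c # d\<close> along the chord from \<open>hd q\<close> to \<open>c\<close> gives the longest path
  \<open>rev q @ c # d\<close>. If \<open>q\<close> is shortest possible, the two ends of \<open>q\<close> both have a neighbour in \<open>d\<close>.\<close>

lemma min_degree_3_K4_model:
  assumes fin: "finite V" and ne: "V \<noteq> {}" and EV: "E \<subseteq> V \<times> V" and sym: "sym E" and irr: "irrefl E"
    and deg: "\<And>v. v \<in> V \<Longrightarrow> 3 \<le> card (E `` {v})"
  shows "\<exists>B. K4_model E V B"
proof -
  define path where
    "path xs \<longleftrightarrow> distinct xs \<and> set xs \<subseteq> V \<and> successively (\<lambda>u v. (u, v) \<in> E) xs" for xs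
  have path_len: "length xs \<le> card V" if "path xs" for xs
    using that fin by (metis path_def card_mono distinct_card)
  define longest where "longest xs \<longleftrightarrow> path xs \<and> (\<forall>ys. path ys \<longrightarrow> length ys \<le> length xs)" for xs
  have E_ne: "u \<noteq> v" if "(u, v) \<in> E" for u v using irr that by (auto simp: irrefl_def)
  have E_sym: "(v, u) \<in> E" if "(u, v) \<in> E" for u v using sym that by (auto dest: symD)
  have third: "\<exists>w. (v, w) \<in> E \<and> w \<noteq> a \<and> w \<noteq> b" if "v \<in> V" for v a b
  proof (rule ccontr)
    assume "\<not> ?thesis"
    then have "E `` {v} \<subseteq> {a, b}" by auto
    then have "card (E `` {v}) \<le> card {a, b}" by (intro card_mono) auto
    also have "\<dots> \<le> 2" by (simp add: card_insert_if)
    finally show False using deg[OF that] by simp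
  qed
  obtain xs where longest_xs: "longest xs"
  proof -
    obtain v where v: "v \<in> V" using ne by auto
    have "path [v]" using v by (simp add: path_def)
    then have "\<exists>xs. path xs \<and> (\<forall>ys. path ys \<longrightarrow> length ys \<le> length xs)"
      using path_len by (intro ex_has_greatest_nat[where b = "Suc (card V)"]) (auto simp: less_Suc_eq_le)
    then show thesis using that unfolding longest_def by blast
  qed
  \<comment> \<open>A neighbour of the first vertex off the path would prolong it.\<close>
  have nbr_in: "w \<in> set xs" if "longest xs" "xs \<noteq> []" "(hd xs, w) \<in> E" for xs w
  proof (rule ccontr)
    assume "w \<notin> set xs"
    then have "path (w # xs)"
      using that EV E_sym unfolding longest_def path_def by (cases xs) auto
    then show False using that(1) unfolding longest_def by fastforce
  qed
  \<comment> \<open>\<open>n\<close> is the distance along a longest path from its first vertex to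
    the other end \<open>c\<close> of an edge; \<open>2 \<le> n\<close> excludes the first edge of
    the path.\<close>
  define chord where "chord n \<longleftrightarrow>
    (\<exists>q c d. longest (q @ c # d) \<and> length q = n \<and> 2 \<le> n \<and> (hd q, c) \<in> E)" for n
  have chordI: "chord (length q1)"
    if "longest (q @ d)" "q = q1 @ w # q2" "2 \<le> length q1" "(hd q, w) \<in> E" for q d q1 q2 w
  proof -
    have "hd q = hd q1" using that by (cases q1) auto
    then show ?thesis
      unfolding chord_def using that by (intro exI[of _ q1] exI[of _ w] exI[of _ "q2 @ d"]) auto
  qed
  have "\<exists>n. chord n"
  proof -
    have "xs \<noteq> []"
    proof
      assume "xs = []"
      moreover obtain v where "v \<in> V" using ne by auto
      moreover then have "path [v]" by (simp add: path_def)
      ultimately show False using longest_xs unfolding longest_def by force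
    qed
    then have "hd xs \<in> V" using longest_xs unfolding longest_def path_def by auto
    then obtain w where w: "(hd xs, w) \<in> E" "w \<noteq> xs ! 1" using third by blast
    then have "w \<in> set xs" using nbr_in longest_xs \<open>xs \<noteq> []\<close> by blast
    then obtain q d where q: "xs = q @ w # d" by (meson split_list)
    have "2 \<le> length q"
    proof (rule ccontr)
      assume "\<not> 2 \<le> length q"
      then consider "q = []" | a where "q = [a]"
        by (metis One_nat_def Suc_1 Suc_leI length_0_conv length_Suc_conv less_one linorder_not_le
            nat_less_le)
      then show False using w q E_ne by cases auto
    qed
    then show ?thesis using chordI[of xs "[]" q w d] longest_xs q w by auto
  qed
  then obtain n where n: "chord n" and n_min: "\<And>m. m < n \<Longrightarrow> \<not> chord m"
    using exists_least_iff[of chord] by blast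
  then obtain q c d where q: "longest (q @ c # d)" "length q = n" "2 \<le> n" "(hd q, c) \<in> E"
    unfolding chord_def by blast
  \<comment> \<open>The first vertex has a neighbour other than \<open>r ! 1\<close> and
    \<open>c\<close>. It is on the path, and inside \<open>r\<close> it would be the end of a
    shorter chord, so it is in \<open>d\<close>.\<close>
  have far: "\<exists>w\<in>set d. (hd r, w) \<in> E" if r: "longest (r @ c # d)" "length r = n" for r
  proof -
    have r0: "hd (r @ c # d) = hd r" "r \<noteq> []" using r q by (cases r; simp)+
    have "hd r \<in> V" using r r0 unfolding longest_def path_def by auto
    then obtain w where w: "(hd r, w) \<in> E" "w \<noteq> r ! 1" "w \<noteq> c" using third by blast
    have "w \<in> set (r @ c # d)" using nbr_in[OF r(1)] r0 w by auto
    moreover have "w \<notin> set r"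
    proof
      assume "w \<in> set r"
      then obtain r1 r2 where r12: "r = r1 @ w # r2" by (meson split_list)
      have "2 \<le> length r1"
      proof (rule ccontr)
        assume "\<not> 2 \<le> length r1"
        then consider "r1 = []" | a where "r1 = [a]"
          by (metis One_nat_def Suc_1 Suc_leI length_0_conv length_Suc_conv less_one linorder_not_le
              nat_less_le)
        then show False using w r12 E_ne by cases auto
      qed
      then have "chord (length r1)" using chordI[OF r(1) r12] w by auto
      then show False using n_min r12 r by auto
    qed
    ultimately show ?thesis using w by auto
  qed
  have path_q: "path (q @ c # d)" using q by (simp add: longest_def)
  have "path (rev q @ c # d)"
    using path_q q(4) E_sym
    by (auto simp: path_def successively_append_iff last_rev successively_rev hd_rev
        elim: successively_mono split: if_splits)
  then have "longest (rev q @ c # d)"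
    using q unfolding longest_def by simp
  then obtain w' where w': "w' \<in> set d" "(last q, w') \<in> E"
    using far[of "rev q"] q by (auto simp: hd_rev)
  obtain w where w: "w \<in> set d" "(hd q, w) \<in> E" using far q by blast
  obtain p b where pb: "q = p @ [b]" "p \<noteq> []"
  proof -
    have "q \<noteq> []" using q by auto
    then obtain p b where "q = p @ [b]" by (metis rev_exhaust)
    moreover then have "p \<noteq> []" using q by auto
    ultimately show thesis using that by blast
  qed
  have suc: "successively (\<lambda>u v. (u, v) \<in> E) p" "(last p, b) \<in> E" "(b, c) \<in> E"
    "d \<noteq> [] \<and> (c, hd d) \<in> E" "successively (\<lambda>u v. (u, v) \<in> E) d"
    using path_q pb w by (auto simp: path_def successively_append_iff successively_Cons)
  define B where "B i = (if i = 0 then set p else if i = 1 then {b} else if i = 2 then {c} else set d)"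
    for i :: nat
  have less4: "i < 4 \<longleftrightarrow> i = 0 \<or> i = 1 \<or> i = 2 \<or> i = 3" for i :: nat by auto
  have less3: "i < 3 \<longleftrightarrow> i = 0 \<or> i = 1 \<or> i = 2" for i :: nat by auto
  have less2: "i < 2 \<longleftrightarrow> i = 0 \<or> i = 1" for i :: nat by auto
  have "conn E (set p)" "conn E (set d)" using conn_path[OF sym] suc pb by auto
  \<comment> \<open>Path edges link \<open>p\<close> to \<open>b\<close>, \<open>b\<close> to
    \<open>c\<close> and \<open>c\<close> to \<open>d\<close>; the chord links \<open>p\<close> to
    \<open>c\<close>; \<open>w\<close> and \<open>w'\<close> link \<open>p\<close> and
    \<open>b\<close> to \<open>d\<close>.\<close>
  moreover have "linked E (set p) {b}" "linked E (set p) {c}" "linked E (set p) (set d)"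
    "linked E {b} {c}" "linked E {b} (set d)" "linked E {c} (set d)"
    using suc w w' pb q(4) unfolding linked_def by (fastforce simp: hd_append)+
  moreover have "set p \<inter> {b} = {}" "set p \<inter> {c} = {}" "set p \<inter> set d = {}" "b \<noteq> c" "b \<notin> set d"
    "c \<notin> set d" "set p \<subseteq> V" "b \<in> V" "c \<in> V" "set d \<subseteq> V"
    using path_q pb by (auto simp: path_def)
  ultimately have "K4_model E V B"
    unfolding K4_model_def less4 by (auto simp: B_def conn_singleton less3 less2)
  then show ?thesis by blast
qed

text \<open>Turns a branch set \<open>X\<close> of the suppressed graph \<open>F\<close> into one of
  \<open>E\<close>: edges of \<open>F\<close> become walks of \<open>E\<close> inside
  \<open>Y\<close>, and each added vertex hangs on \<open>X\<close> by an edge.\<close>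

lemma conn_expand:
  assumes sym: "sym E" and F: "conn F X" and XY: "X \<subseteq> Y"
    and step: "\<And>u v. u \<in> X \<Longrightarrow> v \<in> X \<Longrightarrow> (u, v) \<in> F \<Longrightarrow> (u, v) \<in> (E \<inter> Y \<times> Y)\<^sup>*"
    and new: "\<And>y. y \<in> Y - X \<Longrightarrow> \<exists>x\<in>X. (x, y) \<in> E"
  shows "conn E Y"
proof -
  let ?R = "(E \<inter> Y \<times> Y)\<^sup>*"
  have X: "(x, y) \<in> ?R" if "x \<in> X" "y \<in> X" for x y
  proof -
    have "(x, y) \<in> (F \<inter> X \<times> X)\<^sup>*" using F that by (auto simp: conn_def)
    moreover have "F \<inter> X \<times> X \<subseteq> ?R" using step by auto
    ultimately show ?thesis using rtrancl_subset_rtrancl by blast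
  qed
  have new': "\<exists>x\<in>X. (x, y) \<in> ?R \<and> (y, x) \<in> ?R" if y: "y \<in> Y" for y
  proof (cases "y \<in> X")
    case False
    then obtain x where "x \<in> X" "(x, y) \<in> E" using new[of y] y by auto
    then have "(x, y) \<in> E \<inter> Y \<times> Y" "(y, x) \<in> E \<inter> Y \<times> Y"
      using XY y sym by (auto dest: symD)
    then show ?thesis using \<open>x \<in> X\<close> by blast
  qed auto
  have "(x, y) \<in> ?R" if "x \<in> Y" "y \<in> Y" for x y
    using new'[OF that(1)] new'[OF that(2)] X by (meson rtrancl_trans)
  moreover have "Y \<noteq> {}" using F XY by (auto simp: conn_def)
  ultimately show ?thesis by (auto simp: conn_def)
qed

text \<open>Suppressing the vertices of degree 2 leaves a graph of minimum degree 3; the hypotheses on them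
  prevent loops and parallel edges. A suppressed vertex joins the least branch set it is adjacent to.\<close>

lemma suppression_K4_model:
  assumes fin: "finite W" and ne: "W \<noteq> {}" and sym: "sym E" and irr: "irrefl E"
    and deg: "\<And>v. v \<in> W \<Longrightarrow> card (E `` {v} \<inter> W) \<in> {2, 3}"
    and no22: "\<And>u v. u \<in> W \<Longrightarrow> v \<in> W \<Longrightarrow> (u, v) \<in> E \<Longrightarrow> card (E `` {u} \<inter> W) = 2 \<Longrightarrow>
      card (E `` {v} \<inter> W) = 3"
    and no3: "\<And>v a b. v \<in> W \<Longrightarrow> E `` {v} \<inter> W = {a, b} \<Longrightarrow> (a, b) \<notin> E"
    and no4: "\<And>v w a b. v \<in> W \<Longrightarrow> E `` {v} \<inter> W = {a, b} \<Longrightarrow> a \<noteq> b \<Longrightarrow> w \<in> W \<Longrightarrow> (w, a) \<in> E \<Longrightarrow>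
      (w, b) \<in> E \<Longrightarrow> w = v"
  shows "\<exists>B. K4_model E W B"
proof -
  define T where "T = {v \<in> W. card (E `` {v} \<inter> W) = 3}"
  \<comment> \<open>The suppressed graph: a vertex of degree 2 becomes an edge between its two
    neighbours, which both lie in \<open>T\<close> by \<open>no22\<close>.\<close>
  define F where "F = {(u, v). u \<in> T \<and> v \<in> T \<and> u \<noteq> v \<and>
    ((u, v) \<in> E \<or> (\<exists>w\<in>W - T. (u, w) \<in> E \<and> (w, v) \<in> E))}"
  have E_sym: "(v, u) \<in> E" if "(u, v) \<in> E" for u v using sym that by (auto dest: symD)
  have E_ne: "u \<noteq> v" if "(u, v) \<in> E" for u v using irr that by (auto simp: irrefl_def)
  have TW: "T \<subseteq> W" by (auto simp: T_def)
  have two: "\<exists>v. v \<in> T \<and> v \<noteq> u \<and> E `` {w} \<inter> W = {u, v}"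
    if w: "w \<in> W - T" and uw: "u \<in> W" "(w, u) \<in> E" for w u
  proof -
    have "card (E `` {w} \<inter> W) = 2" using deg[of w] w by (auto simp: T_def)
    moreover from this obtain a b where ab: "E `` {w} \<inter> W = {a, b}" "a \<noteq> b"
      by (meson card_2_iff)
    moreover have "u \<in> {a, b}" using ab uw by auto
    moreover have "a \<in> T" "b \<in> T" using ab no22[of w] w calculation(1) by (auto simp: T_def)
    ultimately show ?thesis by fastforce
  qed
  have T_ne: "T \<noteq> {}"
  proof -
    obtain w where w: "w \<in> W" using ne by auto
    show ?thesis
    proof (cases "w \<in> T")
      case False
      then have "card (E `` {w} \<inter> W) = 2" using deg[of w] w by (auto simp: T_def)
      then have "E `` {w} \<inter> W \<noteq> {}" by auto
      then obtain u where "u \<in> E `` {w} \<inter> W" by blast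
      then show ?thesis using two[of w u] False w by auto
    qed auto
  qed
  have degF: "3 \<le> card (F `` {u})" if u: "u \<in> T" for u
  proof -
    \<comment> \<open>\<open>g x\<close> is the neighbour of \<open>u\<close> in \<open>F\<close>
      that is reached through \<open>x\<close>: \<open>x\<close> itself, or the far neighbour of a
      suppressed \<open>x\<close>.\<close>
    define g where "g x = (if x \<in> T then x else (SOME v. v \<noteq> u \<and> E `` {x} \<inter> W = {u, v}))" for x
    let ?N = "E `` {u} \<inter> W"
    have g: "g x \<in> T \<and> g x \<noteq> u \<and> E `` {x} \<inter> W = {u, g x}" if "x \<in> ?N" "x \<notin> T" for x
    proof -
      have "\<exists>v. v \<in> T \<and> v \<noteq> u \<and> E `` {x} \<inter> W = {u, v}"
        using two[of x u] that E_sym u TW by auto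
      then have "g x \<noteq> u \<and> E `` {x} \<inter> W = {u, g x}"
        unfolding g_def using that(2) by simp (metis (mono_tags, lifting) someI_ex)
      then show ?thesis using \<open>\<exists>v. v \<in> T \<and> _ v\<close> by (metis doubleton_eq_iff)
    qed
    have gT: "g x = x" if "x \<in> T" for x using that by (simp add: g_def)
    \<comment> \<open>Equal images of distinct vertices would put a vertex of degree 2 on a triangle
      (\<open>no3\<close>) or on a 4-cycle (\<open>no4\<close>).\<close>
    have "inj_on g ?N"
    proof (rule inj_onI)
      fix x y assume xy: "x \<in> ?N" "y \<in> ?N" "g x = g y"
      have mixed: False if "x \<in> T" "y \<notin> T" "x \<in> ?N" "y \<in> ?N" "g x = g y" for x y
        using g[of y] gT[of x] that no3[of y u x] by auto
      show "x = y"
      proof (cases "x \<in> T"; cases "y \<in> T")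
        assume "x \<notin> T" "y \<notin> T"
        then have "E `` {x} \<inter> W = {u, g x}" "E `` {y} \<inter> W = {u, g x}" "g x \<noteq> u"
          using g xy by auto
        then show "x = y" using no4[of y u "g x" x] xy by blast
      next
        assume "x \<in> T" "y \<in> T"
        then show "x = y" using xy(3) gT by simp
      next
        assume "x \<in> T" "y \<notin> T"
        then show "x = y" using mixed xy by blast
      next
        assume "x \<notin> T" "y \<in> T"
        then show "x = y" using mixed[of y x] xy by simp
      qed
    qed
    moreover have "g ` ?N \<subseteq> F `` {u}"
    proof
      fix v assume "v \<in> g ` ?N"
      then obtain x where x: "x \<in> ?N" "v = g x" by auto
      show "v \<in> F `` {u}"
      proof (cases "x \<in> T")
        case True
        then show ?thesis using x u gT E_ne by (auto simp: F_def)
      next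
        case False
        then show ?thesis using g[of x] x u by (auto simp: F_def)
      qed
    qed
    moreover have "finite (F `` {u})"
      by (rule finite_subset[OF _ fin]) (auto simp: F_def T_def)
    ultimately have "card ?N \<le> card (F `` {u})"
      by (metis card_image card_mono)
    then show ?thesis using u by (auto simp: T_def)
  qed
  have "sym F" unfolding F_def using E_sym by (intro symI) blast
  moreover have "irrefl F" by (auto simp: F_def irrefl_def)
  moreover have "F \<subseteq> T \<times> T" by (auto simp: F_def)
  moreover have "finite T" using fin TW finite_subset by blast
  ultimately obtain B where B: "K4_model F T B"
    using min_degree_3_K4_model[of T F] T_ne degF by blast
  have BT: "B i \<subseteq> T" "conn F (B i)" if "i < 4" for i using B that by (auto simp: K4_model_def)
  have B_disj: "B i \<inter> B j = {}" if "i < 4" "j < 4" "i \<noteq> j" for i j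
    using B that unfolding K4_model_def by (metis Int_commute linorder_neqE_nat)
  define Y where
    "Y i = B i \<union> {w \<in> W - T. E `` {w} \<inter> B i \<noteq> {} \<and> (\<forall>j<i. E `` {w} \<inter> B j = {})}" for i
  \<comment> \<open>Within \<open>W\<close> the suppressed vertex \<open>w\<close> has only the
    neighbours \<open>u\<close> and \<open>v\<close>, so the least branch set that it touches is
    \<open>B i\<close>. The case \<open>i = j\<close> serves connectedness, the case
    \<open>i < j\<close> the links.\<close>
  have in_Y: "w \<in> Y i"
    if w: "w \<in> W - T" "u \<in> B i" "v \<in> B j" "i \<le> j" "j < 4" "(u, w) \<in> E" "(w, v) \<in> E" "u \<noteq> v"
    for u v w i j
  proof -
    have uv: "u \<in> W" "v \<in> W" using w BT TW by (meson le_less_trans subset_iff)+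
    then have "E `` {w} \<inter> W = {u, v}"
    proof -
      obtain v' where v': "E `` {w} \<inter> W = {u, v'}" using two[of w u] w(1) uv E_sym[OF w(6)] by blast
      moreover have "v \<in> E `` {w} \<inter> W" using w(7) uv by simp
      ultimately have "v = v'" using w(8) by auto
      then show ?thesis using v' by simp
    qed
    then have "E `` {w} \<inter> B k \<subseteq> {u, v} \<inter> B k" if "k < i" for k
      using BT(1)[of k] TW w that by auto
    moreover have "u \<notin> B k \<and> v \<notin> B k" if "k < i" for k
      using B_disj[of k i] B_disj[of k j] w that by auto
    ultimately show ?thesis unfolding Y_def using w E_sym by fastforce
  qed
  have "K4_model E W Y"
    unfolding K4_model_def
  proof (intro conjI allI impI)
    fix i :: nat assume i: "i < 4"
    show "Y i \<subseteq> W" using BT(1)[OF i] TW by (auto simp: Y_def)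
    show "conn E (Y i)"
    proof (rule conn_expand[OF sym BT(2)[OF i]])
      fix u v assume uv: "u \<in> B i" "v \<in> B i" "(u, v) \<in> F"
      then consider "(u, v) \<in> E" | w where "w \<in> W - T" "(u, w) \<in> E" "(w, v) \<in> E" "u \<noteq> v"
        by (auto simp: F_def)
      then show "(u, v) \<in> (E \<inter> Y i \<times> Y i)\<^sup>*"
      proof cases
        case 1
        then show ?thesis using uv by (auto simp: Y_def)
      next
        case 2
        then have "w \<in> Y i" using in_Y[of w u i v i] uv i by auto
        then have "(u, w) \<in> E \<inter> Y i \<times> Y i" "(w, v) \<in> E \<inter> Y i \<times> Y i"
          using 2 uv by (auto simp: Y_def)
        then show ?thesis by (meson converse_rtrancl_into_rtrancl r_into_rtrancl)
      qed
    next
      fix y assume "y \<in> Y i - B i"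
      then show "\<exists>x\<in>B i. (x, y) \<in> E" using E_sym by (auto simp: Y_def)
    qed (auto simp: Y_def)
  next
    fix i j :: nat assume ij: "j < 4" "i < j"
    show "Y i \<inter> Y j = {}"
      using BT(1)[of i] BT(1)[of j] B_disj[of i j] ij by (fastforce simp: Y_def)
    obtain u v where uv: "u \<in> B i" "v \<in> B j" "(u, v) \<in> F"
      using B ij unfolding K4_model_def linked_def by blast
    then consider "(u, v) \<in> E" | w where "w \<in> W - T" "(u, w) \<in> E" "(w, v) \<in> E" "u \<noteq> v"
      by (auto simp: F_def)
    then show "linked E (Y i) (Y j)"
    proof cases
      case 1
      then show ?thesis using uv by (auto simp: Y_def linked_def)
    next
      case 2
      then have "w \<in> Y i" using in_Y[of w u i v j] uv ij by auto
      then show ?thesis using 2 uv by (auto simp: Y_def linked_def)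
    qed
  qed
  then show ?thesis by blast
qed

section \<open>Colouring subcubic graphs without a \<open>K\<^sub>4\<close> minor\<close>

text \<open>The vertices of \<open>S\<close> are recoloured one at a time, each avoiding fewer than
  \<open>k\<close> forbidden colours. The colouring \<open>c\<close> varies in the induction and may
  be improper only at pairs meeting what is left of \<open>S\<close>.\<close>

lemma greedy_extension:
  assumes "finite S" "sym R" "irrefl R"
    and "\<And>v. v \<in> S \<Longrightarrow> finite (R `` {v}) \<and> card (R `` {v}) < k"
    and "\<And>v. c v < k" and "\<And>u v. u \<notin> S \<Longrightarrow> v \<notin> S \<Longrightarrow> (u, v) \<in> R \<Longrightarrow> c u \<noteq> c v"
  shows "\<exists>c' :: 'a \<Rightarrow> nat. (\<forall>v. c' v < k) \<and> (\<forall>(u, v)\<in>R. c' u \<noteq> c' v)"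
  using assms(1,4-)
proof (induction S arbitrary: c rule: finite_induct)
  case empty
  then show ?case by blast
next
  case (insert s S)
  have "card (c ` (R `` {s})) < k"
    using insert.prems(1)[of s] card_image_le[of "R `` {s}" c] by auto
  then obtain x where x: "x < k" "x \<notin> c ` (R `` {s})"
    by (metis card_lessThan card_mono finite_imageI insert.prems(1) insertI1 lessThan_iff
        linorder_not_le subsetI)
  have rs: "(u, s) \<in> R \<Longrightarrow> (s, u) \<in> R" for u using assms(2) by (auto dest: symD)
  show ?case
  proof (rule insert.IH)
    show "(c(s := x)) u \<noteq> (c(s := x)) v" if "u \<notin> S" "v \<notin> S" "(u, v) \<in> R" for u v
      using that x rs insert.prems(3)[of u v] assms(3) by (auto simp: irrefl_def)
  qed (use insert.prems x in auto)
qed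

lemma sym_conflict: "sym E \<Longrightarrow> conflict E W u v \<Longrightarrow> conflict E W v u"
  unfolding conflict_def by (meson symE)

text \<open>Stating the claim for all \<open>W \<subseteq> V\<close> makes it an induction on
  \<open>card W\<close>. Branch sets inside \<open>W\<close> lie inside \<open>V\<close>, so the
  absence of a model is inherited.\<close>

lemma subcubic_K4_free_colouring:
  assumes fin: "finite V" and sym: "sym E" and irr: "irrefl E"
    and deg: "\<And>v. v \<in> V \<Longrightarrow> card (E `` {v} \<inter> V) \<le> 3"
    and K4: "\<nexists>B. K4_model E V B"
  shows "W \<subseteq> V \<Longrightarrow> \<exists>c :: 'a \<Rightarrow> nat. (\<forall>v. c v < 4) \<and> (\<forall>u v. conflict E W u v \<longrightarrow> c u \<noteq> c v)"
proof (induction "card W" arbitrary: W rule: less_induct)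
  case less
  let ?N = "\<lambda>v. E `` {v} \<inter> W"
  have finW: "finite W" using less.prems fin finite_subset by blast
  have E_sym: "(v, u) \<in> E" if "(u, v) \<in> E" for u v using sym that by (auto dest: symD)
  have E_ne: "u \<noteq> v" if "(u, v) \<in> E" for u v using irr that by (auto simp: irrefl_def)
  have finN: "finite (?N v)" for v using finW by simp
  have N3: "card (?N v) \<le> 3" if "v \<in> W" for v
  proof -
    have "card (?N v) \<le> card (E `` {v} \<inter> V)"
      using less.prems fin by (intro card_mono) auto
    then show ?thesis using deg[of v] that less.prems by auto
  qed
  have N2: "card (?N a - {v}) \<le> 2" if "a \<in> W" "v \<in> W" "(v, a) \<in> E" for a v
    using N3[of a] that E_sym finN by (simp add: card_Diff_singleton)
  have N1: "card (?N a - {v} - {w}) \<le> 1"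
    if "a \<in> W" "v \<in> W" "w \<in> W" "(v, a) \<in> E" "(w, a) \<in> E" "w \<noteq> v" for a v w
    using N2[of a v] that E_sym finN by (simp add: card_Diff_singleton)
  have conf_sub: "Collect (conflict E W v) \<subseteq> (\<Union>a\<in>?N v. ?N a - {v}) - ?N v" for v
    by (auto simp: conflict_def)
  \<comment> \<open>Common frame of the four reductions: colour \<open>W - S\<close> by induction
    and extend greedily to \<open>S\<close>. By \<open>keep\<close>, that colouring already
    separates all conflicting pairs outside \<open>S\<close>.\<close>
  have reduce: ?case
    if S: "S \<subseteq> W" "S \<noteq> {}"
      and few: "\<And>v. v \<in> S \<Longrightarrow> card (Collect (conflict E W v)) \<le> 3"
      and keep: "\<And>u v. u \<notin> S \<Longrightarrow> v \<notin> S \<Longrightarrow> conflict E W u v \<Longrightarrow> conflict E (W - S) u v" for S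
  proof -
    have "card (W - S) < card W"
      using S finW by (intro psubset_card_mono) auto
    then obtain c :: "'a \<Rightarrow> nat" where
      c: "\<forall>v. c v < 4" "\<forall>u v. conflict E (W - S) u v \<longrightarrow> c u \<noteq> c v"
      using less.hyps[of "W - S"] less.prems by blast
    let ?R = "{(u, v). conflict E W u v}"
    have RI: "?R `` {v} = Collect (conflict E W v)" for v by auto
    have "\<exists>c' :: 'a \<Rightarrow> nat. (\<forall>v. c' v < 4) \<and> (\<forall>(u, v)\<in>?R. c' u \<noteq> c' v)"
    proof (rule greedy_extension[where c = c])
      show "finite S" using S finW finite_subset by blast
      show "sym ?R" using sym_conflict[OF sym] by (auto intro: symI)
      show "irrefl ?R" by (auto simp: irrefl_def conflict_def)
      show "finite (?R `` {v}) \<and> card (?R `` {v}) < 4" if "v \<in> S" for v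
      proof
        show "finite (?R `` {v})"
          by (rule finite_subset[OF _ finW]) (auto simp: conflict_def)
        show "card (?R `` {v}) < 4" using few[OF that] unfolding RI by simp
      qed
      show "c v < 4" for v using c(1) by simp
      show "c u \<noteq> c v" if "u \<notin> S" "v \<notin> S" "(u, v) \<in> ?R" for u v
        using that c(2) keep[of u v] by simp
    qed
    then show ?thesis by auto
  qed
  \<comment> \<open>A vertex with at most one neighbour is the middle of no path of length 2, so its
    deletion loses no conflict. Its own conflicts are among the neighbours of
    \<open>a\<close>.\<close>
  have one: ?case if one: "v \<in> W" "card (?N v) \<le> 1" for v
  proof -
    have "\<exists>a. ?N v \<subseteq> {a}"
    proof (cases "card (?N v) = 0")
      case True
      then show ?thesis using finN[of v] by simp
    next
      case False
      then have "card (?N v) = 1" using one by linarith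
      then show ?thesis by (metis card_1_singletonE order_refl)
    qed
    then obtain a where a: "?N v \<subseteq> {a}" by blast
    show ?thesis
    proof (rule reduce[of "{v}"])
      show "card (Collect (conflict E W u)) \<le> 3" if u: "u \<in> {v}" for u
      proof (cases "?N v = {}")
        case True
        then have "Collect (conflict E W u) = {}" using conf_sub[of v] u by blast
        then show ?thesis by (simp only: card.empty)
      next
        case False
        then have Nv: "?N v = {a}" using a by blast
        have "Collect (conflict E W u) \<subseteq> ?N a" using conf_sub[of v] u unfolding Nv by blast
        then have "card (Collect (conflict E W u)) \<le> card (?N a)" by (rule card_mono[OF finN])
        moreover have "a \<in> W" using Nv by blast
        ultimately show ?thesis using N3[of a] by linarith
      qed
      show "conflict E (W - {v}) x y" if xy: "x \<notin> {v}" "y \<notin> {v}" "conflict E W x y" for x y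
      proof -
        obtain w where w: "w \<in> W" "(x, w) \<in> E" "(w, y) \<in> E" "x \<in> W" "y \<in> W" "x \<noteq> y" "(x, y) \<notin> E"
          using xy by (auto simp: conflict_def)
        then have "x \<in> ?N w" "y \<in> ?N w" using E_sym by auto
        then have "w \<noteq> v" using a \<open>x \<noteq> y\<close> by blast
        then show ?thesis using w xy by (auto simp: conflict_def)
      qed
    qed (use one(1) in auto)
  qed
  \<comment> \<open>A path of length 2 through \<open>u\<close> ends in \<open>v\<close> and vice
    versa, so both are deleted together; deleting \<open>u\<close> alone could lose a conflict of
    \<open>v\<close>. The conflicts of \<open>u\<close> are \<open>b\<close> and at most two further
    neighbours of \<open>a\<close>.\<close>
  have adj: ?case
    if adj: "u \<in> W" "v \<in> W" "(u, v) \<in> E" "card (?N u) = 2" "card (?N v) = 2" for u v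
  proof -
    have other: "\<exists>a. a \<in> W \<and> a \<noteq> v \<and> (u, a) \<in> E \<and> ?N u = {a, v}"
      if "card (?N u) = 2" "(u, v) \<in> E" "v \<in> W" for u v
    proof -
      obtain x y where "?N u = {x, y}" "x \<noteq> y" using \<open>card (?N u) = 2\<close> by (meson card_2_iff)
      moreover have "v \<in> ?N u" using that by auto
      ultimately obtain z where "?N u = {z, v}" "z \<noteq> v" by (metis insertE insert_commute singletonD)
      moreover then have "z \<in> W" "(u, z) \<in> E" by blast+
      ultimately show ?thesis by blast
    qed
    have few: "card (Collect (conflict E W u)) \<le> 3"
      if uv: "u \<in> W" "v \<in> W" "(u, v) \<in> E" "card (?N u) = 2" "card (?N v) = 2" for u v
    proof -
      obtain a where a: "a \<in> W" "(u, a) \<in> E" "?N u = {a, v}" using other uv by blast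
      obtain b where b: "?N v = {b, u}" using other[of v u] uv E_sym by blast
      have "Collect (conflict E W u) \<subseteq> (?N a - {u}) \<union> {b}"
        using conf_sub[of u] unfolding a(3) using b by auto
      then have "card (Collect (conflict E W u)) \<le> card ((?N a - {u}) \<union> {b})"
        using finN by (intro card_mono) auto
      also have "\<dots> \<le> card (?N a - {u}) + 1"
        using card_Un_le[of "?N a - {u}" "{b}"] by simp
      finally show ?thesis using N2[of a u] a uv by auto
    qed
    obtain a where a: "?N u = {a, v}" using other adj by blast
    obtain b where b: "?N v = {b, u}" using other[of v u] adj E_sym by blast
    show ?thesis
    proof (rule reduce[of "{u, v}"])
      show "card (Collect (conflict E W x)) \<le> 3" if "x \<in> {u, v}" for x
        using that few[of u v] few[of v u] adj E_sym by auto
      show "conflict E (W - {u, v}) x y" if xy: "x \<notin> {u, v}" "y \<notin> {u, v}" "conflict E W x y" for x y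
      proof -
        obtain w where w: "w \<in> W" "(x, w) \<in> E" "(w, y) \<in> E" "x \<in> W" "y \<in> W" "x \<noteq> y" "(x, y) \<notin> E"
          using xy by (auto simp: conflict_def)
        then have "x \<in> ?N w" "y \<in> ?N w" using E_sym by auto
        then have "w = u \<Longrightarrow> x \<in> {a, v} \<and> y \<in> {a, v}" "w = v \<Longrightarrow> x \<in> {b, u} \<and> y \<in> {b, u}"
          using a b by blast+
        then have "w \<noteq> u" "w \<noteq> v" using xy(1,2) \<open>x \<noteq> y\<close> by blast+
        then show ?thesis using w xy by (auto simp: conflict_def)
      qed
    qed (use adj(1,2) in auto)
  qed
  \<comment> \<open>The only pair with middle vertex \<open>v\<close> is \<open>a\<close>,
    \<open>b\<close>, and it is adjacent. Each of \<open>a\<close> and \<open>b\<close> contributes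
    at most one conflict of \<open>v\<close>.\<close>
  have three: ?case if three: "v \<in> W" "?N v = {a, b}" "(a, b) \<in> E" for v a b
  proof -
    from three have ab: "a \<in> W" "b \<in> W" "(v, a) \<in> E" "(v, b) \<in> E" "a \<noteq> v" "b \<noteq> v" "(b, a) \<in> E"
      using E_sym E_ne by blast+
    show ?thesis
    proof (rule reduce[of "{v}"])
      have "Collect (conflict E W v) \<subseteq> (?N a - {v} - {b}) \<union> (?N b - {v} - {a})"
        using conf_sub[of v] unfolding three(2) by auto
      then have "card (Collect (conflict E W v)) \<le> card ((?N a - {v} - {b}) \<union> (?N b - {v} - {a}))"
        using finN by (intro card_mono) auto
      also have "\<dots> \<le> card (?N a - {v} - {b}) + card (?N b - {v} - {a})" by (rule card_Un_le)
      finally have "card (Collect (conflict E W v)) \<le> 3"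
        using N1[of a v b] N1[of b v a] ab three by auto
      then show "card (Collect (conflict E W x)) \<le> 3" if "x \<in> {v}" for x using that by auto
      show "conflict E (W - {v}) x y" if xy: "x \<notin> {v}" "y \<notin> {v}" "conflict E W x y" for x y
      proof -
        obtain w where w: "w \<in> W" "(x, w) \<in> E" "(w, y) \<in> E" "x \<in> W" "y \<in> W" "x \<noteq> y" "(x, y) \<notin> E"
          using xy by (auto simp: conflict_def)
        then have "x \<in> ?N w" "y \<in> ?N w" using E_sym by auto
        then have "w = v \<Longrightarrow> x \<in> {a, b} \<and> y \<in> {a, b}" using three(2) by blast
        then have "w \<noteq> v" using three(3) ab(7) w(6,7) by blast
        then show ?thesis using w xy by (auto simp: conflict_def)
      qed
    qed (use three(1) in auto)
  qed
  \<comment> \<open>After deleting \<open>v\<close>, the vertex \<open>w\<close> still witnesses the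
    conflict between \<open>a\<close> and \<open>b\<close>. The conflicts of \<open>v\<close> are at
    most \<open>w\<close> and one further neighbour of each of \<open>a\<close> and
    \<open>b\<close>.\<close>
  have four: ?case
    if four: "v \<in> W" "?N v = {a, b}" "a \<noteq> b" "w \<in> W" "(w, a) \<in> E" "(w, b) \<in> E" "w \<noteq> v" for v a b w
  proof -
    from four have ab: "a \<in> W" "b \<in> W" "(v, a) \<in> E" "(v, b) \<in> E" by blast+
    show ?thesis
    proof (rule reduce[of "{v}"])
      have "Collect (conflict E W v) \<subseteq> insert w ((?N a - {v} - {w}) \<union> (?N b - {v} - {w}))"
        using conf_sub[of v] unfolding four(2) by auto
      then have "card (Collect (conflict E W v)) \<le>
          card (insert w ((?N a - {v} - {w}) \<union> (?N b - {v} - {w})))"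
        using finN by (intro card_mono) auto
      also have "\<dots> \<le> Suc (card (?N a - {v} - {w}) + card (?N b - {v} - {w}))"
        using card_Un_le[of "?N a - {v} - {w}" "?N b - {v} - {w}"] finN by (simp add: card_insert_if)
      finally have "card (Collect (conflict E W v)) \<le> 3"
        using N1[of a v w] N1[of b v w] ab four by auto
      then show "card (Collect (conflict E W x)) \<le> 3" if "x \<in> {v}" for x using that by auto
      show "conflict E (W - {v}) x y" if xy: "x \<notin> {v}" "y \<notin> {v}" "conflict E W x y" for x y
      proof -
        obtain z where z: "z \<in> W" "(x, z) \<in> E" "(z, y) \<in> E" "x \<in> W" "y \<in> W" "x \<noteq> y" "(x, y) \<notin> E"
          using xy by (auto simp: conflict_def)
        have "\<exists>z\<in>W - {v}. (x, z) \<in> E \<and> (z, y) \<in> E"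
        proof (cases "z = v")
          case True
          then have "x \<in> ?N v" "y \<in> ?N v" using z E_sym by auto
          then have "(x, w) \<in> E" "(w, y) \<in> E" using four E_sym by auto
          then show ?thesis using four by blast
        qed (use z in blast)
        then show ?thesis using z xy by (auto simp: conflict_def)
      qed
    qed (use four(1) in auto)
  qed
  show ?case
  proof (cases "W = {}")
    case True
    then show ?thesis by (intro exI[of _ "\<lambda>_. 0"]) (auto simp: conflict_def)
  next
    case False
    show ?thesis
    proof (rule ccontr)
      assume irred: "\<not> ?thesis"
      have N23: "card (?N v) \<in> {2, 3}" if "v \<in> W" for v
      proof -
        have "\<not> card (?N v) \<le> 1" using one[OF that] irred by blast
        then show ?thesis using N3[OF that] by auto
      qed
      \<comment> \<open>The failure of each reduction supplies one hypothesis of the suppression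
        lemma.\<close>
      have "\<exists>B. K4_model E W B"
      proof (rule suppression_K4_model[OF finW False sym irr N23])
        show "card (?N v) = 3" if "u \<in> W" "v \<in> W" "(u, v) \<in> E" "card (?N u) = 2" for u v
          using adj[OF that] irred N23[OF that(2)] by blast
        show "(a, b) \<notin> E" if "v \<in> W" "?N v = {a, b}" for v a b
          using three[OF that] irred by blast
        show "w = v"
          if "v \<in> W" "?N v = {a, b}" "a \<noteq> b" "w \<in> W" "(w, a) \<in> E" "(w, b) \<in> E" for v w a b
          using four[OF that] irred by blast
      qed
      then show False using K4 less.prems unfolding K4_model_def by blast
    qed
  qed
qed

section \<open>Graph notions expressed through the arc relation\<close>

context pair_graph
begin

lemma sym_parcs: "sym (parcs G)"
  using pair_sym_arcs by (simp add: symmetric_def)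

lemma irrefl_parcs: "irrefl (parcs G)"
  using pair_no_loops by (fastforce simp: irrefl_def)

text \<open>Connectedness is strong connectedness of the symmetric closure, which adds no arcs here
  because \<open>parcs G\<close> is symmetric.\<close>

lemma connected_induce_iff_conn:
  "Digraph_Component.connected (induce_subgraph (with_proj G) X) \<longleftrightarrow> conn (parcs G) X"
proof -
  let ?H = "mk_symmetric (induce_subgraph (with_proj G) X)"
  have arcs: "parcs ?H = parcs G \<inter> X \<times> X"
    using symD[OF sym_parcs] by (fastforce simp: parcs_mk_symmetric)
  interpret H: pair_wf_digraph ?H
    using wellformed_induce_subgraph by (rule wf_digraph.wellformed_mk_symmetric)
  show ?thesis
    unfolding Digraph_Component.connected_def strongly_connected_def conn_def
    using H.reachable_conv' by (simp add: arcs)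
qed

text \<open>A model gives the complete graph on \<open>{..<4}\<close> as a minor. Conversely, an
  enumeration \<open>h\<close> of the vertices of any complete \<open>H\<close> on four vertices
  reindexes its branch sets.\<close>

lemma K4_minor_free_iff: "K4_minor_free G \<longleftrightarrow> (\<nexists>B. K4_model (parcs G) (pverts G) B)"
proof -
  have "is_minor H G" if "K4_model (parcs G) (pverts G) B" "complete_digraph 4 (with_proj H)"
    "pverts H = {..<4}" for B and H :: "nat pair_pre_digraph"
  proof -
    have arcs: "parcs H = {(x, y). x < 4 \<and> y < 4 \<and> x \<noteq> y}"
      using that(2,3) by (auto simp: complete_digraph_pair_def)
    have B: "B i \<inter> B j = {} \<and> linked (parcs G) (B i) (B j)" if "i < 4" "j < 4" "i \<noteq> j" for i j
    proof (cases "i < j")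
      case True
      then show ?thesis using \<open>K4_model _ _ B\<close> that by (auto simp: K4_model_def)
    next
      case False
      then have "B j \<inter> B i = {} \<and> linked (parcs G) (B j) (B i)"
        using \<open>K4_model _ _ B\<close> that by (auto simp: K4_model_def)
      then show ?thesis using symD[OF sym_parcs] unfolding linked_def by blast
    qed
    show ?thesis
      unfolding is_minor_def connected_induce_iff_conn that(3) arcs
      using B \<open>K4_model _ _ B\<close>
      by (intro exI[of _ B]) (auto simp: K4_model_def linked_def)
  qed
  moreover have "\<exists>B. K4_model (parcs G) (pverts G) B"
    if K: "complete_digraph 4 (with_proj H)" and "is_minor H G" for H :: "nat pair_pre_digraph"
  proof -
    obtain B where B: "\<forall>x\<in>pverts H. B x \<subseteq> pverts G \<and> conn (parcs G) (B x)"
      "\<forall>x\<in>pverts H. \<forall>y\<in>pverts H. x \<noteq> y \<longrightarrow> B x \<inter> B y = {}"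
      "\<forall>(x, y)\<in>parcs H. linked (parcs G) (B x) (B y)"
      using \<open>is_minor H G\<close> unfolding is_minor_def connected_induce_iff_conn linked_def
      by (elim exE conjE) (rule that; simp add: linked_def)
    have H: "card (pverts H) = 4" "finite (pverts H)"
      "parcs H = {(x, y). x \<in> pverts H \<and> y \<in> pverts H \<and> x \<noteq> y}"
      using K unfolding complete_digraph_pair_def by auto
    obtain h :: "nat \<Rightarrow> nat" where h: "bij_betw h {0..<4} (pverts H)"
      using ex_bij_betw_nat_finite[OF H(2)] unfolding H(1) by blast
    have hH: "h i \<in> pverts H" if "i < 4" for i
      by (rule bij_betw_apply[OF h]) (simp add: that)
    have h_ne: "h i \<noteq> h j" if "i < j" "j < 4" for i j
    proof
      assume "h i = h j"
      then have "i = j"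
        by (rule inj_onD[OF bij_betw_imp_inj_on[OF h]]) (use that in simp_all)
      then show False using that by simp
    qed
    have "K4_model (parcs G) (pverts G) (B \<circ> h)"
      unfolding K4_model_def
    proof (intro conjI allI impI)
      fix i j :: nat assume ij: "j < 4" "i < j"
      then have hij: "h i \<in> pverts H" "h j \<in> pverts H" "h i \<noteq> h j"
        using hH[of i] hH[of j] h_ne[of i j] by simp_all
      then show "(B \<circ> h) i \<inter> (B \<circ> h) j = {}" using B(2) unfolding comp_def by blast
      have "(h i, h j) \<in> parcs H" using hij unfolding H(3) by blast
      then show "linked (parcs G) ((B \<circ> h) i) ((B \<circ> h) j)" using B(3) unfolding comp_def by blast
    next
      fix i :: nat assume "i < 4"
      then have "h i \<in> pverts H" by (rule hH)
      then show "(B \<circ> h) i \<subseteq> pverts G" "conn (parcs G) ((B \<circ> h) i)"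
        using B(1) unfolding comp_def by blast+
    qed
    then show ?thesis by blast
  qed
  moreover have "\<exists>H :: nat pair_pre_digraph. complete_digraph 4 (with_proj H) \<and> pverts H = {..<4}"
    by (rule exI[of _ "\<lparr>pverts = {..<4}, parcs = {(u, v). u \<in> {..<4} \<and> v \<in> {..<4} \<and> u \<noteq> v}\<rparr>"])
      (auto simp: complete_digraph_pair_def)
  ultimately show ?thesis unfolding K4_minor_free_def by blast
qed

lemma out_degree_eq: "out_degree (with_proj G) v = card (parcs G `` {v})"
proof -
  have "out_arcs (with_proj G) v = Pair v ` (parcs G `` {v})" by (auto simp: out_arcs_def)
  then show ?thesis by (simp add: out_degree_def card_image inj_on_def)
qed

lemma max_degree_le_iff:
  "max_degree G \<le> k \<longleftrightarrow> (\<forall>v\<in>pverts G. card (parcs G `` {v}) \<le> k)"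
  by (simp add: max_degree_def out_degree_eq pair_finite_verts)

lemma graph_dist_eq_2_iff:
  assumes "u \<in> pverts G" "v \<in> pverts G"
  shows "graph_dist G u v = 2 \<longleftrightarrow> conflict (parcs G) (pverts G) u v"
proof -
  have cost: "awalk_cost (\<lambda>_. 1) p = length p" for p
    by (induction p) auto
  have dist: "graph_dist G u v = (INF p\<in>{p. awalk u p v}. ereal (length p))"
    unfolding graph_dist_def \<mu>_def cost by simp
  have len0: "awalk u [] v \<longleftrightarrow> u = v" using assms by (auto simp: awalk_def)
  have len1: "(\<exists>p. awalk u p v \<and> length p = 1) \<longleftrightarrow> (u, v) \<in> parcs G"
    using assms by (auto simp: awalk_def length_Suc_conv intro!: exI[of _ "[(u, v)]"])
  have len2: "(\<exists>p. awalk u p v \<and> length p = 2) \<longleftrightarrow> (\<exists>w. (u, w) \<in> parcs G \<and> (w, v) \<in> parcs G)"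
  proof
    assume "\<exists>p. awalk u p v \<and> length p = 2"
    then obtain p where "awalk u p v" "length p = 2" by blast
    then show "\<exists>w. (u, w) \<in> parcs G \<and> (w, v) \<in> parcs G"
      by (auto simp: awalk_def length_Suc_conv numeral_2_eq_2)
  next
    assume "\<exists>w. (u, w) \<in> parcs G \<and> (w, v) \<in> parcs G"
    then obtain w where "(u, w) \<in> parcs G" "(w, v) \<in> parcs G" by blast
    then show "\<exists>p. awalk u p v \<and> length p = 2"
      using assms by (intro exI[of _ "[(u, w), (w, v)]"]) (auto simp: awalk_def)
  qed
  have le: "graph_dist G u v \<le> ereal (length p)" if "awalk u p v" for p
    unfolding dist using that by (auto intro: INF_lower)
  show ?thesis
  proof
    assume d: "graph_dist G u v = 2"
    have short: "2 \<le> length p" if "awalk u p v" for p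
    proof -
      have "ereal 2 \<le> ereal (length p)" using le[OF that] d by simp
      then show ?thesis by simp
    qed
    \<comment> \<open>Comparison with 3 produces an actual walk of fewer than 3 arcs; as no walk is
      shorter than 2, it attains the infimum.\<close>
    have "graph_dist G u v < ereal 3" using d by simp
    then obtain p where p: "awalk u p v" "length p < 3"
      unfolding dist INF_less_iff by auto
    then have "length p = 2" using short[OF p(1)] by simp
    then obtain w where "(u, w) \<in> parcs G" "(w, v) \<in> parcs G" using len2 p(1) by blast
    moreover have "u \<noteq> v" using short[of "[]"] len0 by auto
    moreover have "(u, v) \<notin> parcs G" using len1 short by fastforce
    ultimately show "conflict (parcs G) (pverts G) u v"
      using assms in_arcsD1 unfolding conflict_def by blast
  next
    assume c: "conflict (parcs G) (pverts G) u v"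
    then obtain p where p: "awalk u p v" "length p = 2" using len2 unfolding conflict_def by blast
    have "2 \<le> length p" if "awalk u p v" for p
    proof (rule ccontr)
      assume "\<not> 2 \<le> length p"
      then consider "length p = 0" | "length p = 1" by linarith
      then show False using c len0 len1 that by cases (auto simp: conflict_def)
    qed
    then have "2 \<le> graph_dist G u v"
      unfolding dist by (auto intro!: INF_greatest)
    then show "graph_dist G u v = 2" using le[OF p(1)] p(2) by (simp add: antisym)
  qed
qed

lemma exact_square_coloring_iff:
  "exact_square_coloring G c \<longleftrightarrow> (\<forall>u v. conflict (parcs G) (pverts G) u v \<longrightarrow> c u \<noteq> c v)"
proof -
  have "u \<in> pverts G \<and> v \<in> pverts G" if "conflict (parcs G) (pverts G) u v" for u v
    using that by (simp add: conflict_def)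
  then show ?thesis unfolding exact_square_coloring_def using graph_dist_eq_2_iff by blast
qed

lemma exact_square_chromatic_number_le:
  fixes c :: "'a \<Rightarrow> nat"
  assumes "\<And>u v. conflict (parcs G) (pverts G) u v \<Longrightarrow> c u \<noteq> c v" "\<And>v. c v < k"
  shows "exact_square_chromatic_number G \<le> k"
proof -
  have "exact_square_chromatic_number G \<le> card (c ` pverts G)"
    unfolding exact_square_chromatic_number_def
    using assms(1) by (intro Least_le exI[of _ c]) (simp add: exact_square_coloring_iff)
  also have "\<dots> \<le> card {..<k}" using assms(2) by (intro card_mono) auto
  finally show ?thesis by simp
qed

text \<open>An injective colouring exists because the graph is finite, so the \<open>LEAST\<close>
  is attained by some colouring, to which the assumption applies.\<close>

lemma exact_square_chromatic_number_ge:
  assumes "\<And>c :: 'a \<Rightarrow> nat. (\<And>u v. conflict (parcs G) (pverts G) u v \<Longrightarrow> c u \<noteq> c v) \<Longrightarrow>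
    k \<le> card (c ` pverts G)"
  shows "k \<le> exact_square_chromatic_number G"
proof -
  obtain f :: "'a \<Rightarrow> nat" where "inj_on f (pverts G)"
    using finite_imp_inj_to_nat_seg[OF pair_finite_verts] by metis
  then have "exact_square_coloring G f"
    unfolding exact_square_coloring_iff conflict_def inj_on_def by blast
  then have "\<exists>k. \<exists>c :: 'a \<Rightarrow> nat. exact_square_coloring G c \<and> card (c ` pverts G) = k" by blast
  then have "\<exists>c :: 'a \<Rightarrow> nat. exact_square_coloring G c \<and>
      card (c ` pverts G) = exact_square_chromatic_number G"
    unfolding exact_square_chromatic_number_def by (rule LeastI_ex)
  then obtain c :: "'a \<Rightarrow> nat" where "exact_square_coloring G c"
    "card (c ` pverts G) = exact_square_chromatic_number G"
    by blast
  then show ?thesis using assms[of c] by (simp add: exact_square_coloring_iff)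
qed

lemma subcubic_K4_minor_free_le_4:
  assumes "K4_minor_free G" "max_degree G \<le> 3"
  shows "exact_square_chromatic_number G \<le> 4"
proof -
  have "parcs G `` {v} \<inter> pverts G = parcs G `` {v}" for v using in_arcsD2 by auto
  then have "\<exists>c :: 'a \<Rightarrow> nat. (\<forall>v. c v < 4) \<and>
      (\<forall>u v. conflict (parcs G) (pverts G) u v \<longrightarrow> c u \<noteq> c v)"
    using assms pair_finite_verts sym_parcs irrefl_parcs
    by (intro subcubic_K4_free_colouring[of "pverts G"])
      (auto simp: K4_minor_free_iff max_degree_le_iff)
  then show ?thesis using exact_square_chromatic_number_le by blast
qed

end

section \<open>The bipartite example\<close>

text \<open>At least two of four branch sets avoid the hubs \<open>p\<close> and \<open>q\<close>; as they are adjacent, one of them is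
  \<open>{u}\<close> where \<open>u\<close> has a single neighbour outside the other one, so it is not adjacent to both
  remaining branch sets.\<close>

lemma two_hubs_K4_free:
  assumes sym: "sym E"
    and paths: "\<And>u v. (u, v) \<in> E \<Longrightarrow> u \<notin> {p, q} \<Longrightarrow> v \<notin> {p, q} \<Longrightarrow> \<exists>h\<in>{p, q}. E `` {u} \<subseteq> {h, v}"
  shows "\<nexists>B. K4_model E V B"
proof
  assume "\<exists>B. K4_model E V B"
  then obtain B where B: "K4_model E V B" ..
  have disj: "B i \<inter> B j = {}" and link: "linked E (B i) (B j)" if "i < 4" "j < 4" "i \<noteq> j" for i j
  proof -
    have *: "B i \<inter> B j = {} \<and> linked E (B i) (B j)" if "i < j" "j < 4" for i j
      using B that by (auto simp: K4_model_def)
    show "B i \<inter> B j = {}" using *[of i j] *[of j i] that by (metis Int_commute linorder_neqE_nat)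
    show "linked E (B i) (B j)"
      using *[of i j] *[of j i] that symD[OF sym] unfolding linked_def by (metis linorder_neqE_nat)
  qed
  \<comment> \<open>A vertex lies in at most one branch set; if it lies in none, \<open>k\<close> is
    arbitrary.\<close>
  have hub: "\<exists>k. \<forall>i<4. h \<in> B i \<longrightarrow> i = k" for h
    using disj by (metis disjoint_iff)
  obtain k l where kl: "\<And>i. i < 4 \<Longrightarrow> p \<in> B i \<Longrightarrow> i = k" "\<And>i. i < 4 \<Longrightarrow> q \<in> B i \<Longrightarrow> i = l"
    using hub[of p] hub[of q] by blast
  have two: "\<exists>i j. i < 4 \<and> j < 4 \<and> i \<noteq> j \<and> i \<notin> {k, l} \<and> j \<notin> {k, l}" for k l :: nat
  proof -
    have "\<exists>i<4. i \<notin> {a, b, c}" for a b c :: nat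
    proof (rule ccontr)
      assume "\<not> ?thesis"
      then have "{..<4} \<subseteq> {a, b, c}" by auto
      then have "card {..<4::nat} \<le> card {a, b, c}" by (intro card_mono) auto
      also have "\<dots> \<le> 3" by (simp add: card_insert_if)
      finally show False by simp
    qed
    then show ?thesis by (metis insertCI)
  qed
  obtain i j where ij: "i < 4" "j < 4" "i \<noteq> j" "i \<notin> {k, l}" "j \<notin> {k, l}" using two by blast
  have no_hub: "p \<notin> B i" "q \<notin> B i" "p \<notin> B j" "q \<notin> B j" using kl ij by blast+
  obtain u v where uv: "u \<in> B i" "v \<in> B j" "(u, v) \<in> E" using link[OF ij(1-3)] by (auto simp: linked_def)
  moreover have "u \<notin> {p, q}" "v \<notin> {p, q}" using no_hub uv(1,2) by auto
  ultimately obtain h where h: "h \<in> {p, q}" "E `` {u} \<subseteq> {h, v}" using paths by blast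
  have "v \<notin> B i" using disj[OF ij(1-3)] uv by blast
  then have "E `` {u} \<inter> B i = {}" using h no_hub by blast
  \<comment> \<open>All neighbours of \<open>u\<close> are outside the connected set
    \<open>B i\<close>, so nothing else can be reached from \<open>u\<close> within it.\<close>
  have "B i = {u}"
  proof (rule ccontr)
    assume "B i \<noteq> {u}"
    then obtain y where "y \<in> B i" "y \<noteq> u" using uv(1) by blast
    moreover have "conn E (B i)" using B ij(1) by (simp add: K4_model_def)
    ultimately have "(u, y) \<in> (E \<inter> B i \<times> B i)\<^sup>*" using uv(1) by (simp add: conn_def)
    then show False using \<open>y \<noteq> u\<close> \<open>E `` {u} \<inter> B i = {}\<close> by (cases rule: converse_rtranclE) auto
  qed
  obtain k' l' where kl': "k' < 4" "l' < 4" "k' \<noteq> l'" "k' \<notin> {i, j}" "l' \<notin> {i, j}" using two by blast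
  \<comment> \<open>Each remaining branch set contains a neighbour of \<open>u\<close>, and
    \<open>h\<close> is the only candidate; two disjoint sets cannot share it.\<close>
  have "h \<in> B m" if m: "m < 4" "m \<notin> {i, j}" for m
  proof -
    obtain w where "w \<in> B m" "(u, w) \<in> E"
      using link[of i m] m ij(1) \<open>B i = {u}\<close> by (auto simp: linked_def)
    moreover have "v \<notin> B m" using disj[of j m] m ij(2) uv(2) by auto
    ultimately show ?thesis using h(2) by blast
  qed
  then show False using disj[OF kl'(1-3)] kl' by blast
qed

section \<open>Graphs given by edge lists\<close>

definition graph_of :: "nat \<Rightarrow> (nat \<times> nat) list \<Rightarrow> nat pair_pre_digraph" where
  "graph_of n es = \<lparr>pverts = {..<n}, parcs = set es \<union> (set es)\<inverse>\<rparr>"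

text \<open>Executable neighbourhoods, so that properties of the concrete graphs can be decided by
  evaluation.\<close>

definition nbrs :: "(nat \<times> nat) list \<Rightarrow> nat \<Rightarrow> nat list" where
  "nbrs es v = map snd (filter (\<lambda>e. fst e = v) es) @ map fst (filter (\<lambda>e. snd e = v) es)"

lemma graph_of_simps [simp]:
  "pverts (graph_of n es) = {..<n}" "parcs (graph_of n es) = set es \<union> (set es)\<inverse>"
  by (simp_all add: graph_of_def)

lemma mem_parcs_graph_of: "(u, v) \<in> parcs (graph_of n es) \<longleftrightarrow> v \<in> set (nbrs es u)"
  by (force simp: nbrs_def)

lemma parcs_graph_of_Image: "parcs (graph_of n es) `` {u} = set (nbrs es u)"
  using mem_parcs_graph_of by blast

lemma pair_graph_graph_of:
  assumes "list_all (\<lambda>(u, v). u < v \<and> v < n) es"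
  shows "pair_graph (graph_of n es)"
proof -
  have "u < v \<and> v < n" if "(u, v) \<in> set es" for u v
    using assms that by (auto simp: list_all_iff)
  then show ?thesis
    by unfold_locales (auto simp: symmetric_def intro!: symI dest: less_trans, fastforce+)
qed

lemma max_degree_graph_of_le:
  assumes "list_all (\<lambda>(u, v). u < v \<and> v < n) es" "list_all (\<lambda>v. length (nbrs es v) \<le> k) [0..<n]"
  shows "max_degree (graph_of n es) \<le> k"
  unfolding pair_graph.max_degree_le_iff[OF pair_graph_graph_of[OF assms(1)]] parcs_graph_of_Image
  using assms(2) by (auto simp: list_all_iff intro: order_trans[OF card_length])

lemma conflict_graph_ofI:
  assumes "u < n" "v < n" "w < n" "u \<noteq> v" "v \<notin> set (nbrs es u)" "w \<in> set (nbrs es u)" "v \<in> set (nbrs es w)"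
  shows "conflict (parcs (graph_of n es)) (pverts (graph_of n es)) u v"
  using assms unfolding conflict_def mem_parcs_graph_of by auto

text \<open>Conflicting vertices have a common neighbour, so it suffices that no colour repeats in a
  neighbourhood. This asks for more than an exact square colouring but is checked vertex by
  vertex.\<close>

lemma chromatic_number_graph_of_le:
  assumes "list_all (\<lambda>(u, v). u < v \<and> v < n) es"
    and distinct: "list_all (\<lambda>w. distinct (map c (nbrs es w))) [0..<n]"
    and "\<And>v. c v < k"
  shows "exact_square_chromatic_number (graph_of n es) \<le> k"
proof -
  interpret pair_graph "graph_of n es" using assms(1) by (rule pair_graph_graph_of)
  show ?thesis
  proof (rule exact_square_chromatic_number_le)
    fix u v assume "conflict (parcs (graph_of n es)) (pverts (graph_of n es)) u v"
    then obtain w where "u \<noteq> v" "w < n" "u \<in> set (nbrs es w)" "v \<in> set (nbrs es w)"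
      unfolding conflict_def using symD[OF sym_parcs] by (auto simp flip: mem_parcs_graph_of[of _ _ n])
    moreover then have "distinct (map c (nbrs es w))" using distinct by (simp add: list_all_iff)
    ultimately show "c u \<noteq> c v" by (auto simp: distinct_map inj_on_def)
  qed (rule assms(3))
qed

text \<open>The hubs are 0 and 1, the paths 0-2-3-1, 0-4-5-1 and 0-6-7-1.\<close>

definition theta_edges :: "(nat \<times> nat) list" where
  "theta_edges = [(0,2), (2,3), (1,3), (0,4), (4,5), (1,5), (0,6), (6,7), (1,7)]"

abbreviation "theta \<equiv> graph_of 8 theta_edges"

lemma pair_graph_theta: "pair_graph theta"
  by (rule pair_graph_graph_of) (simp add: theta_edges_def)

lemma theta_K4_minor_free: "K4_minor_free theta"
proof -
  interpret pair_graph theta by (rule pair_graph_theta)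
  show ?thesis
    unfolding K4_minor_free_iff
  proof (rule two_hubs_K4_free[OF sym_parcs, where p = 0 and q = 1])
    fix u v assume "(u, v) \<in> parcs theta" "u \<notin> {0, 1}" "v \<notin> {0, 1}"
    then have "(u, v) \<in> {(2,3), (4,5), (6,7), (3,2), (5,4), (7,6)}"
      by (auto simp: theta_edges_def)
    then show "\<exists>h\<in>{0, 1}. parcs theta `` {u} \<subseteq> {h, v}"
      unfolding parcs_graph_of_Image by (auto simp: theta_edges_def nbrs_def)
  qed
qed

lemma theta_bipartite: "bipartite theta"
  unfolding bipartite_def
  \<comment> \<open>One side consists of the hub 0 and the neighbours of the hub 1.\<close>
  by (rule exI[of _ "{..<8} \<inter> {0, 3, 5, 7}"], rule exI[of _ "{..<8} - {0, 3, 5, 7}"])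
    (auto simp: theta_edges_def)

lemma theta_max_degree: "max_degree theta \<le> 3"
  by (rule max_degree_graph_of_le; code_simp)

text \<open>This excludes 4-cycles; evaluation over all pairs shows that distinct vertices have at
  most one common neighbour.\<close>

lemma theta_common_neighbours:
  assumes "(a, b) \<in> parcs theta" "(c, b) \<in> parcs theta" "(a, d) \<in> parcs theta" "(c, d) \<in> parcs theta" "b \<noteq> d"
  shows "a = c"
proof -
  interpret pair_graph theta by (rule pair_graph_theta)
  let ?common = "\<lambda>a c. filter (\<lambda>b. b \<in> set (nbrs theta_edges c)) (nbrs theta_edges a)"
  have "list_all (\<lambda>a. list_all (\<lambda>c. length (?common a c) \<le> 1 \<or> a = c) [0..<8]) [0..<8]"
    by code_simp
  moreover have "a \<in> set [0..<8]" "c \<in> set [0..<8]"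
    using in_arcsD1[OF assms(1)] in_arcsD1[OF assms(2)] by simp_all
  ultimately have "length (?common a c) \<le> 1 \<or> a = c" unfolding list_all_iff by blast
  moreover have "2 \<le> length (?common a c)"
  proof -
    have "{b, d} \<subseteq> set (?common a c)"
      using assms unfolding mem_parcs_graph_of by auto
    then have "card {b, d} \<le> length (?common a c)"
      by (meson List.finite_set card_length card_mono order_trans)
    then show ?thesis using assms by simp
  qed
  ultimately show ?thesis by linarith
qed

text \<open>Cycles of length 3 and 5 contradict the bipartition \<open>s\<close>; in a cycle of
  length 4, opposite vertices would share two neighbours.\<close>

lemma theta_girth: "6 \<le> girth theta"
proof -
  interpret pair_graph theta by (rule pair_graph_theta)
  define s where "s v \<longleftrightarrow> v \<in> {0, 3, 5, 7}" for v :: nat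
  have flip: "s u \<longleftrightarrow> \<not> s v" if "(u, v) \<in> parcs theta" for u v
    using that by (auto simp: s_def theta_edges_def)
  have opp: "(v, u) \<in> parcs theta" if "(u, v) \<in> parcs theta" for u v
    using that symD[OF sym_parcs] by blast
  have "6 \<le> length p" if p: "cycle p" "3 \<le> length p" for p
  proof (rule ccontr)
    assume "\<not> 6 \<le> length p"
    then consider "length p = 3" | "length p = 4" | "length p = 5" using p(2) by linarith
    moreover obtain u where u: "pcas u p u" "distinct (tl (pawalk_verts u p))" "set p \<subseteq> parcs theta"
      using p(1) by (auto simp: cycle_def awalk_def)
    ultimately show False
    proof cases
      case 1
      then obtain a b c where "p = [(u, a), (a, b), (b, u)]"
        using u(1) by (auto simp: length_Suc_conv numeral_eq_Suc)
      then show False using u(3) flip[of u a] flip[of a b] flip[of b u] by (simp del: graph_of_simps)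
    next
      case 2
      then obtain a b c where abc: "p = [(u, a), (a, b), (b, c), (c, u)]"
        using u(1) by (auto simp: length_Suc_conv numeral_eq_Suc)
      then have "u = b"
        using u(2,3) opp by (intro theta_common_neighbours[of u a b c]) (auto simp del: graph_of_simps)
      then show False using u(2) abc by simp
    next
      case 3
      then obtain a b c d where "p = [(u, a), (a, b), (b, c), (c, d), (d, u)]"
        using u(1) by (auto simp: length_Suc_conv numeral_eq_Suc)
      then show False
        using u(3) flip[of u a] flip[of a b] flip[of b c] flip[of c d] flip[of d u]
        by (simp del: graph_of_simps)
    qed
  qed
  then show ?thesis unfolding girth_def by (auto intro!: INF_greatest simp: numeral_eq_enat)
qed

text \<open>The vertices 1, 2, 4, 6 are pairwise at distance 2: the last three through the hub 0,
  and 1 with each of them through 3, 5, 7. The upper bound is the general one.\<close>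

lemma theta_chromatic_number: "exact_square_chromatic_number theta = 4"
proof (rule antisym)
  interpret pair_graph theta by (rule pair_graph_theta)
  show "exact_square_chromatic_number theta \<le> 4"
    using theta_K4_minor_free theta_max_degree by (rule subcubic_K4_minor_free_le_4)
  show "4 \<le> exact_square_chromatic_number theta"
  proof (rule exact_square_chromatic_number_ge)
    fix c :: "nat \<Rightarrow> nat"
    assume c: "\<And>u v. conflict (parcs theta) (pverts theta) u v \<Longrightarrow> c u \<noteq> c v"
    have ne: "c u \<noteq> c v"
      if "u < 8" "v < 8" "w < 8" "u \<noteq> v" "v \<notin> set (nbrs theta_edges u)"
        "w \<in> set (nbrs theta_edges u)" "v \<in> set (nbrs theta_edges w)" for u v w
      using that by (intro c conflict_graph_ofI)
    have "c 2 \<noteq> c 4" "c 2 \<noteq> c 6" "c 4 \<noteq> c 6" "c 1 \<noteq> c 2" "c 1 \<noteq> c 4" "c 1 \<noteq> c 6"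
      using ne[of 2 4 0] ne[of 2 6 0] ne[of 4 6 0] ne[of 1 2 3] ne[of 1 4 5] ne[of 1 6 7]
      by (simp_all add: theta_edges_def nbrs_def)
    then have "card {c 1, c 2, c 4, c 6} = 4" by simp
    moreover have "{c 1, c 2, c 4, c 6} \<subseteq> c ` pverts theta" by auto
    ultimately show "4 \<le> card (c ` pverts theta)"
      by (metis card_mono finite_imageI pair_finite_verts)
  qed
qed

section \<open>The outerplanar example\<close>

text \<open>Vertices on a parabola are in convex position: a straight-line drawing stays in the epigraph, so
  every vertex is on the outer face, and chords with noncrossing indices meet only in endpoints.\<close>

definition parabola :: "nat \<Rightarrow> complex" where
  "parabola n = Complex (real n) ((real n)\<^sup>2)"

lemma parabola_simps [simp]: "Re (parabola n) = real n" "Im (parabola n) = (real n)\<^sup>2"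
  by (simp_all add: parabola_def)

lemma parabola_eq_iff [simp]: "parabola m = parabola n \<longleftrightarrow> m = n"
  by (auto simp: complex_eq_iff)

text \<open>At abscissa \<open>x\<close> the chord lies above the parabola by
  \<open>(x - u) * (v - x)\<close>, which vanishes only at its two ends.\<close>

lemma parabola_chordD:
  assumes "z \<in> closed_segment (parabola u) (parabola v)" "u < v"
  shows "real u \<le> Re z" "Re z \<le> real v" "Im z = (Re z)\<^sup>2 + (Re z - u) * (v - Re z)"
proof -
  obtain t where t: "0 \<le> t" "t \<le> 1" "z = (1 - t) *\<^sub>R parabola u + t *\<^sub>R parabola v"
    using assms(1) by (auto simp: in_segment)
  have re: "Re z = u + t * (real v - u)" and im: "Im z = (1 - t) * (real u)\<^sup>2 + t * (real v)\<^sup>2"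
    unfolding t(3) by (simp_all add: left_diff_distrib right_diff_distrib)
  have "0 \<le> t * (real v - u)" "0 \<le> (1 - t) * (real v - u)" using t assms(2) by simp_all
  then show "real u \<le> Re z" "Re z \<le> real v" unfolding re by (simp_all add: algebra_simps)
  show "Im z = (Re z)\<^sup>2 + (Re z - u) * (v - Re z)"
    unfolding re im by (simp add: algebra_simps power2_eq_square)
qed

lemma parabola_chord_vertex:
  assumes "parabola w \<in> closed_segment (parabola u) (parabola v)" "u < v"
  shows "w = u \<or> w = v"
  using parabola_chordD(3)[OF assms] by auto

text \<open>The heights of the outer and the inner chord differ by
  \<open>(x - c) * (b - d) + (c - a) * (b - x)\<close>. Both terms are nonnegative, so both vanish
  at a common point.\<close>

lemma parabola_chords_nested:
  assumes z: "z \<in> closed_segment (parabola a) (parabola b)" "z \<in> closed_segment (parabola c) (parabola d)"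
    and less: "a < b" "c < d" and nest: "a \<le> c" "d \<le> b" "(a, b) \<noteq> (c, d)"
  shows "z \<in> parabola ` ({a, b} \<inter> {c, d})"
proof -
  define x where "x = Re z"
  note ab = parabola_chordD[OF z(1) less(1), folded x_def] and cd = parabola_chordD[OF z(2) less(2), folded x_def]
  have eq: "(x - a) * (b - x) = (x - c) * (d - x)" using ab(3) cd(3) by simp
  have "(x - a) * (b - x) = (x - c) * (d - x) + (x - c) * (real b - d) + (real c - a) * (b - x)"
    by (simp add: algebra_simps)
  then have "(x - c) * (real b - d) + (real c - a) * (b - x) = 0" using eq by simp
  moreover have "0 \<le> (x - c) * (real b - d)" "0 \<le> (real c - a) * (b - x)"
    using ab cd nest by simp_all
  ultimately have "(x - c) * (real b - d) = 0" "(real c - a) * (b - x) = 0" by linarith+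
  \<comment> \<open>The first and last cases contradict \<open>nest\<close> and \<open>less\<close>;
    the other two are a shared left end and a shared right end.\<close>
  then consider "c = a" "d = b" | "x = c" "c = a" | "x = b" "d = b" | "x = c" "x = b"
    by force
  then show ?thesis
  proof cases
    case 1
    then show ?thesis using nest by simp
  next
    case 2
    then have "z = parabola a" using ab(3) by (simp add: complex_eq_iff x_def)
    then show ?thesis using 2 by simp
  next
    case 3
    then have "z = parabola b" using ab(3) by (simp add: complex_eq_iff x_def)
    then show ?thesis using 3 by simp
  next
    case 4
    then show ?thesis using less nest by simp
  qed
qed

text \<open>The index intervals of noncrossing chords are nested or have at most an end in
  common.\<close>

lemma parabola_chords:
  assumes z: "z \<in> closed_segment (parabola a) (parabola b)" "z \<in> closed_segment (parabola c) (parabola d)"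
    and less: "a < b" "c < d" and ne: "(a, b) \<noteq> (c, d)"
    and nocross: "\<not> (a < c \<and> c < b \<and> b < d)" "\<not> (c < a \<and> a < d \<and> d < b)"
  shows "z \<in> parabola ` ({a, b} \<inter> {c, d})"
proof -
  note ab = parabola_chordD[OF z(1) less(1)] and cd = parabola_chordD[OF z(2) less(2)]
  consider "b \<le> c" | "d \<le> a" | "a \<le> c" "d \<le> b" | "c \<le> a" "b \<le> d"
    using nocross less by linarith
  then show ?thesis
  proof cases
    case 1
    then have "Re z = b" "b = c" using ab cd by simp_all
    then have "z = parabola b" using ab(3) by (simp add: complex_eq_iff)
    then show ?thesis using \<open>b = c\<close> by simp
  next
    case 2
    then have "Re z = a" "d = a" using ab cd by simp_all
    then have "z = parabola a" using ab(3) by (simp add: complex_eq_iff)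
    then show ?thesis using \<open>d = a\<close> by simp
  next
    case 3
    then show ?thesis using parabola_chords_nested[OF z less] ne by blast
  next
    case 4
    then show ?thesis using parabola_chords_nested[OF z(2,1) less(2,1)] ne by auto
  qed
qed

lemma convex_epigraph_square: "convex {z. (Re z)\<^sup>2 \<le> Im z}"
proof (rule convexI)
  fix z w :: complex and s t :: real
  assume z: "z \<in> {z. (Re z)\<^sup>2 \<le> Im z}" and w: "w \<in> {z. (Re z)\<^sup>2 \<le> Im z}"
    and st: "0 \<le> s" "0 \<le> t" "s + t = 1"
  have "(s * Re z + t * Re w)\<^sup>2 \<le> s * (Re z)\<^sup>2 + t * (Re w)\<^sup>2"
  proof -
    have t: "t = 1 - s" using st by simp
    have "s * (Re z)\<^sup>2 + t * (Re w)\<^sup>2 - (s * Re z + t * Re w)\<^sup>2 = s * t * (Re z - Re w)\<^sup>2"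
      unfolding t by (simp add: algebra_simps power2_eq_square)
    moreover have "0 \<le> s * t * (Re z - Re w)\<^sup>2" using st by simp
    ultimately show ?thesis by linarith
  qed
  also have "\<dots> \<le> s * Im z + t * Im w"
    using z w st by (intro add_mono mult_left_mono) auto
  finally show "s *\<^sub>R z + t *\<^sub>R w \<in> {z. (Re z)\<^sup>2 \<le> Im z}" by simp
qed

text \<open>The complement of the convex epigraph lies in the outer face and contains points just
  below \<open>parabola n\<close>, while \<open>parabola n\<close> itself belongs to
  \<open>D\<close>.\<close>

lemma parabola_frontier_outside:
  assumes D: "D \<subseteq> {z. (Re z)\<^sup>2 \<le> Im z}" and n: "parabola n \<in> D"
  shows "parabola n \<in> frontier (outside D)"
proof -
  let ?C = "{z. (Re z)\<^sup>2 \<le> Im z}"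
  have sub: "- ?C \<subseteq> outside D"
    using outside_mono[OF D] outside_convex[OF convex_epigraph_square] by simp
  have "parabola n \<in> closure (- ?C)"
    unfolding closure_approachable
  proof (intro allI impI)
    fix e :: real assume "0 < e"
    then have "parabola n - complex_of_real (e / 2) * \<i> \<in> - ?C"
      "dist (parabola n - complex_of_real (e / 2) * \<i>) (parabola n) < e"
      by (simp_all add: dist_norm norm_mult)
    then show "\<exists>y\<in>- ?C. dist y (parabola n) < e" by blast
  qed
  then have "parabola n \<in> closure (outside D)" using closure_mono[OF sub] by blast
  moreover have "parabola n \<notin> interior (outside D)"
    using n interior_subset outside_no_overlap[of D] by blast
  ultimately show ?thesis by (simp add: frontier_def)
qed

text \<open>The straight-line drawing with \<open>v\<close> placed at \<open>parabola (f v)\<close>.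
  One crossing pattern suffices in \<open>nocross\<close>, since it ranges over both orientations
  and both orders of the edges.\<close>

lemma (in pair_graph) outerplanar_of_noncrossing:
  fixes f :: "'a \<Rightarrow> nat"
  assumes inj: "inj_on f (pverts G)"
    and nocross: "\<And>a b c d. (a, b) \<in> parcs G \<Longrightarrow> (c, d) \<in> parcs G \<Longrightarrow>
      \<not> (f a < f c \<and> f c < f b \<and> f b < f d)"
  shows "outerplanar G"
proof -
  let ?f = "parabola \<circ> f"
  let ?g = "\<lambda>(u, v). linepath (?f u) (?f v)"
  have opp: "(v, u) \<in> parcs G" if "(u, v) \<in> parcs G" for u v
    using that symD[OF sym_parcs] by blast
  have f_eq: "f u = f v \<longleftrightarrow> u = v" if "u \<in> pverts G" "v \<in> pverts G" for u v
    using inj that by (auto simp: inj_on_def)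
  have f_ne: "f u \<noteq> f v" if "(u, v) \<in> parcs G" for u v
    using that f_eq[OF in_arcsD1[OF that] in_arcsD2[OF that]] no_loops' by blast
  have meet: "closed_segment (?f a) (?f b) \<inter> closed_segment (?f c) (?f d) \<subseteq> ?f ` ({a, b} \<inter> {c, d})"
    if arcs: "(a, b) \<in> parcs G" "(c, d) \<in> parcs G" "{a, b} \<noteq> {c, d}" and less: "f a < f b" "f c < f d"
    for a b c d
  proof
    fix z assume "z \<in> closed_segment (?f a) (?f b) \<inter> closed_segment (?f c) (?f d)"
    moreover have V: "{a, b, c, d} \<subseteq> pverts G" using arcs in_arcsD1 in_arcsD2 by blast
    moreover have "(f a, f b) \<noteq> (f c, f d)" using arcs(3) V f_eq by auto
    ultimately have "z \<in> parabola ` ({f a, f b} \<inter> {f c, f d})"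
      using parabola_chords[of z "f a" "f b" "f c" "f d"] less nocross[OF arcs(1,2)] nocross[OF arcs(2,1)]
      by auto
    moreover have "{f a, f b} \<inter> {f c, f d} \<subseteq> f ` ({a, b} \<inter> {c, d})" using V f_eq by auto
    ultimately show "z \<in> ?f ` ({a, b} \<inter> {c, d})" unfolding image_comp[symmetric] by blast
  qed
  \<comment> \<open>Segments do not depend on orientation, so reversing arcs reduces every case to
    \<open>meet\<close>.\<close>
  have meet': "closed_segment (?f a) (?f b) \<inter> closed_segment (?f c) (?f d) \<subseteq> ?f ` ({a, b} \<inter> {c, d})"
    if arcs: "(a, b) \<in> parcs G" "(c, d) \<in> parcs G" "{a, b} \<noteq> {c, d}" for a b c d
  proof -
    have sw: "closed_segment (?f b) (?f a) = closed_segment (?f a) (?f b)"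
      "closed_segment (?f d) (?f c) = closed_segment (?f c) (?f d)"
      "{b, a} = {a, b}" "{d, c} = {c, d}"
      by (auto simp: closed_segment_commute)
    consider "f a < f b" "f c < f d" | "f b < f a" "f c < f d" | "f a < f b" "f d < f c"
      | "f b < f a" "f d < f c"
      using f_ne[OF arcs(1)] f_ne[OF arcs(2)] by linarith
    then show ?thesis
    proof cases
      case 1
      then show ?thesis using meet[of a b c d] arcs by blast
    next
      case 2
      then show ?thesis using meet[of b a c d, unfolded sw] arcs opp by blast
    next
      case 3
      then show ?thesis using meet[of a b d c, unfolded sw] arcs opp by blast
    next
      case 4
      then show ?thesis using meet[of b a d c, unfolded sw] arcs opp by blast
    qed
  qed
  have vert: "closed_segment (?f u) (?f v) \<inter> ?f ` pverts G = {?f u, ?f v}" if uv: "(u, v) \<in> parcs G" for u v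
  proof -
    have "w = u \<or> w = v" if "?f w \<in> closed_segment (?f u) (?f v)" "w \<in> pverts G" for w
    proof (cases "f u < f v")
      case True
      then show ?thesis
        using parabola_chord_vertex[of "f w" "f u" "f v"] that f_eq in_arcsD1[OF uv] in_arcsD2[OF uv] by auto
    next
      case False
      then have "f v < f u" using f_ne[OF uv] by simp
      then show ?thesis
        using parabola_chord_vertex[of "f w" "f v" "f u"] that f_eq in_arcsD1[OF uv] in_arcsD2[OF uv]
        by (auto simp: closed_segment_commute)
    qed
    then show ?thesis using in_arcsD1[OF uv] in_arcsD2[OF uv] by auto
  qed
  have "plane_drawing G ?f ?g"
    unfolding plane_drawing_def
  proof (intro conjI ballI, goal_cases)
    case 1
    show ?case using inj by (auto simp: inj_on_def)
  next
    case (2 e)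
    obtain u v where e: "e = (u, v)" by fastforce
    then have uv: "(u, v) \<in> parcs G" using 2 by simp
    show ?case
      unfolding e prod.case path_image_linepath vert[OF uv] using f_ne[OF uv] by (simp add: arc_linepath)
  next
    case (3 e)
    obtain a b where e: "e = (a, b)" by fastforce
    then have "(a, b) \<in> parcs G" using 3 by simp
    then show ?case using meet' unfolding e prod.case path_image_linepath by blast
  qed
  moreover have "?f ` pverts G \<subseteq> frontier (outside (drawing_image G ?f ?g))"
  proof -
    let ?C = "{z. (Re z)\<^sup>2 \<le> Im z}"
    have "closed_segment (?f u) (?f v) \<subseteq> ?C" for u v
      by (rule closed_segment_subset[OF _ _ convex_epigraph_square]) simp_all
    then have "drawing_image G ?f ?g \<subseteq> ?C"
      unfolding drawing_image_def by (auto simp: subset_iff)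
    moreover have "?f ` pverts G \<subseteq> drawing_image G ?f ?g" by (simp add: drawing_image_def)
    ultimately show ?thesis using parabola_frontier_outside unfolding comp_def by blast
  qed
  ultimately show ?thesis unfolding outerplanar_def by blast
qed

lemma outerplanar_graph_of:
  assumes "list_all (\<lambda>(u, v). u < v \<and> v < n) es"
    and nocross: "list_all (\<lambda>(a, b). list_all (\<lambda>(c, d). \<not> (a < c \<and> c < b \<and> b < d)) es) es"
  shows "outerplanar (graph_of n es)"
proof -
  interpret pair_graph "graph_of n es" using assms(1) by (rule pair_graph_graph_of)
  show ?thesis
  proof (rule outerplanar_of_noncrossing[of id])
    fix a b c d assume arcs: "(a, b) \<in> parcs (graph_of n es)" "(c, d) \<in> parcs (graph_of n es)"
    have forward: "(u, v) \<in> set es" if "(u, v) \<in> parcs (graph_of n es)" "u < v" for u v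
      using assms(1) that by (auto simp: list_all_iff)
    show "\<not> (id a < id c \<and> id c < id b \<and> id b < id d)"
    proof
      assume cross: "id a < id c \<and> id c < id b \<and> id b < id d"
      then have "(a, b) \<in> set es" "(c, d) \<in> set es"
        using forward[OF arcs(1)] forward[OF arcs(2)] by auto
      then show False using nocross cross by (fastforce simp: list_all_iff)
    qed
  qed simp
qed

text \<open>Two pentagons sharing the edge between \<open>k + 2\<close> and \<open>k + 6\<close>, attached to \<open>t\<close> at \<open>k\<close>. In a triple
  of \<open>gadget_conflicts\<close> the middle vertex is a common neighbour of the other two.\<close>

definition gadget_edges :: "nat \<Rightarrow> nat \<Rightarrow> (nat \<times> nat) list" where
  "gadget_edges t k = [(k, k+1), (k+1, k+2), (k+2, k+3), (k+3, k+4), (k+4, k+5), (k+5, k+6),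
     (k+6, k+7), (k, k+7), (k+2, k+6), (k, t)]"

definition gadget_conflicts :: "nat \<Rightarrow> nat \<Rightarrow> (nat \<times> nat \<times> nat) list" where
  "gadget_conflicts t k = [(t, k, k+1), (t, k, k+7), (k+1, k, k+7), (k, k+1, k+2), (k, k+7, k+6),
     (k+1, k+2, k+6), (k+1, k+2, k+3), (k+6, k+2, k+3), (k+2, k+6, k+7), (k+5, k+6, k+2),
     (k+5, k+6, k+7), (k+3, k+4, k+5)]"

text \<open>By \<open>S\<close> there are at most three colours. If \<open>t\<close> and
  \<open>k\<close> agree, then \<open>k+1\<close> and \<open>k+7\<close> get the two other colours,
  \<open>k+2\<close> repeats that of \<open>k+1\<close>, and \<open>k+6\<close> that of
  \<open>k+7\<close>. Then \<open>k+3\<close> and \<open>k+5\<close> are both forced to the colour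
  of \<open>t\<close>, though they conflict.\<close>

lemma gadget:
  assumes S: "\<And>w x y z. w \<in> S \<Longrightarrow> x \<in> S \<Longrightarrow> y \<in> S \<Longrightarrow> z \<in> S \<Longrightarrow> \<not> distinct [w, x, y, z]"
    and c: "c ` ({k..k+7} \<union> {t}) \<subseteq> S"
    and ne: "\<And>u w v. (u, w, v) \<in> set (gadget_conflicts t k) \<Longrightarrow> c u \<noteq> c v"
  shows "c t \<noteq> c k"
proof
  assume tk: "c t = c k"
  have third: "u = v" if "x \<in> S" "y \<in> S" "u \<in> S" "v \<in> S" "x \<noteq> y" "u \<noteq> x" "u \<noteq> y" "v \<noteq> x" "v \<noteq> y" for x y u v
    using S[of x y u v] that by auto
  have mem: "c t \<in> S" "c (k+1) \<in> S" "c (k+2) \<in> S" "c (k+3) \<in> S" "c (k+5) \<in> S" "c (k+6) \<in> S" "c (k+7) \<in> S"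
    using c by auto
  have ne': "c t \<noteq> c (k+1)" "c t \<noteq> c (k+7)" "c (k+1) \<noteq> c (k+7)" "c k \<noteq> c (k+2)" "c k \<noteq> c (k+6)"
    "c (k+1) \<noteq> c (k+6)" "c (k+1) \<noteq> c (k+3)" "c (k+6) \<noteq> c (k+3)" "c (k+2) \<noteq> c (k+7)" "c (k+5) \<noteq> c (k+2)"
    "c (k+5) \<noteq> c (k+7)" "c (k+3) \<noteq> c (k+5)"
    by (rule ne, simp add: gadget_conflicts_def, blast?)+
  have z: "c (k+2) = c (k+1)"
    by (rule third[of "c t" "c (k+7)"]) (use mem ne' tk in auto)
  have z': "c (k+6) = c (k+7)"
    by (rule third[of "c t" "c (k+1)"]) (use mem ne' tk in auto)
  have "c (k+3) = c t"
    by (rule third[of "c (k+1)" "c (k+7)"]) (use mem ne' z' in auto)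
  moreover have "c (k+5) = c t"
    by (rule third[of "c (k+1)" "c (k+7)"]) (use mem ne' z in auto)
  ultimately show False using ne' by simp
qed

text \<open>The centre is 24 and each gadget takes eight consecutive labels; in this order no two
  edges cross.\<close>

definition tripod_edges :: "(nat \<times> nat) list" where
  "tripod_edges = concat (map (gadget_edges 24) [0, 8, 16])"

abbreviation "tripod \<equiv> graph_of 25 tripod_edges"

lemma tripod_edges_ordered: "list_all (\<lambda>(u, v). u < v \<and> v < 25) tripod_edges"
  by code_simp

lemmas pair_graph_tripod = pair_graph_graph_of[OF tripod_edges_ordered]

lemma tripod_outerplanar: "outerplanar tripod"
  by (rule outerplanar_graph_of[OF tripod_edges_ordered]) code_simp

lemma tripod_max_degree: "max_degree tripod \<le> 3"
  by (rule max_degree_graph_of_le[OF tripod_edges_ordered]) code_simp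

definition tripod_conflicts :: "(nat \<times> nat \<times> nat) list" where
  "tripod_conflicts =
     [(0, 24, 8), (0, 24, 16), (8, 24, 16)] @ concat (map (gadget_conflicts 24) [0, 8, 16])"

lemma tripod_conflictsD:
  assumes "(u, w, v) \<in> set tripod_conflicts"
  shows "conflict (parcs tripod) (pverts tripod) u v"
proof -
  have "list_all (\<lambda>(u, w, v). u < 25 \<and> v < 25 \<and> w < 25 \<and> u \<noteq> v \<and> v \<notin> set (nbrs tripod_edges u) \<and>
    w \<in> set (nbrs tripod_edges u) \<and> v \<in> set (nbrs tripod_edges w)) tripod_conflicts"
    by code_simp
  from this[unfolded list_all_iff, THEN bspec, OF assms] show ?thesis
    unfolding prod.case by (intro conflict_graph_ofI[of u 25 v w]; elim conjE)
qed

text \<open>The neighbours 0, 8, 16 of the centre are pairwise in conflict. With three colours the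
  gadgets would make the centre differ from all of them, which takes a fourth colour.\<close>

lemma tripod_chromatic_number: "exact_square_chromatic_number tripod = 4"
proof (rule antisym)
  interpret pair_graph tripod by (rule pair_graph_tripod)
  show "exact_square_chromatic_number tripod \<le> 4"
    \<comment> \<open>An explicit colouring with colours 0 to 3, checked by evaluation.\<close>
    by (rule chromatic_number_graph_of_le[OF tripod_edges_ordered, where c = "\<lambda>v.
          if v \<in> set [0, 1, 4, 5, 9, 10, 17, 18] then 0 else if v \<in> set [6, 7, 13, 14, 16, 21] then 2
          else if v \<in> set [22, 24] then 3 else 1"], code_simp) simp
  show "4 \<le> exact_square_chromatic_number tripod"
  proof (rule exact_square_chromatic_number_ge, rule ccontr)
    fix c :: "nat \<Rightarrow> nat"
    assume c: "\<And>u v. conflict (parcs tripod) (pverts tripod) u v \<Longrightarrow> c u \<noteq> c v"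
      and "\<not> 4 \<le> card (c ` pverts tripod)"
    then have few: "card (c ` {..<25}) \<le> 3" by simp
    have S: "\<not> distinct [w, x, y, z]"
      if "w \<in> c ` {..<25}" "x \<in> c ` {..<25}" "y \<in> c ` {..<25}" "z \<in> c ` {..<25}" for w x y z
    proof
      assume "distinct [w, x, y, z]"
      then have "card {w, x, y, z} = 4" by simp
      moreover have "card {w, x, y, z} \<le> card (c ` {..<25})" using that by (intro card_mono) auto
      ultimately show False using few by simp
    qed
    have ne: "c u \<noteq> c v" if "(u, w, v) \<in> set tripod_conflicts" for u w v
      using tripod_conflictsD[OF that] by (rule c)
    have set_T: "set tripod_conflicts = {(0, 24, 8), (0, 24, 16), (8, 24, 16)} \<union>
        (\<Union>k\<in>{0, 8, 16}. set (gadget_conflicts 24 k))"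
      by (simp add: tripod_conflicts_def)
    have "c 24 \<noteq> c k" if "k \<in> {0, 8, 16}" for k
    proof (rule gadget[where c = c and k = k and t = 24, OF S])
      show "c ` ({k..k+7} \<union> {24}) \<subseteq> c ` {..<25}" using that by auto
      show "c u \<noteq> c v" if "(u, w, v) \<in> set (gadget_conflicts 24 k)" for u w v
      proof (rule ne)
        show "(u, w, v) \<in> set tripod_conflicts"
          unfolding set_T using \<open>k \<in> {0, 8, 16}\<close> that by (rule UnI2[OF UN_I])
      qed
    qed
    moreover have "c 0 \<noteq> c 8" "c 0 \<noteq> c 16" "c 8 \<noteq> c 16"
      using ne[of 0 24 8] ne[of 0 24 16] ne[of 8 24 16] by (simp_all add: set_T)
    ultimately have "distinct [c 24, c 0, c 8, c 16]" by simp
    then show False using S[of "c 24" "c 0" "c 8" "c 16"] by simp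
  qed
qed

theorem theorem10:
  shows "(\<forall>G :: 'a pair_pre_digraph.
            pair_graph G \<and> K4_minor_free G \<and> max_degree G \<le> 3 \<longrightarrow>
            exact_square_chromatic_number G \<le> 4)
       \<and> (\<exists>G\<^sub>1 :: nat pair_pre_digraph.
            pair_graph G\<^sub>1 \<and> bipartite G\<^sub>1 \<and> K4_minor_free G\<^sub>1 \<and> max_degree G\<^sub>1 \<le> 3 \<and>
            girth G\<^sub>1 \<ge> 6 \<and> exact_square_chromatic_number G\<^sub>1 = 4)
       \<and> (\<exists>G\<^sub>2 :: nat pair_pre_digraph.
            pair_graph G\<^sub>2 \<and> outerplanar G\<^sub>2 \<and> max_degree G\<^sub>2 \<le> 3 \<and>
            exact_square_chromatic_number G\<^sub>2 = 4)"
proof (intro conjI)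
  show "\<exists>G\<^sub>1 :: nat pair_pre_digraph.
    pair_graph G\<^sub>1 \<and> bipartite G\<^sub>1 \<and> K4_minor_free G\<^sub>1 \<and> max_degree G\<^sub>1 \<le> 3 \<and>
    girth G\<^sub>1 \<ge> 6 \<and> exact_square_chromatic_number G\<^sub>1 = 4"
    using pair_graph_theta theta_bipartite theta_K4_minor_free theta_max_degree theta_girth
      theta_chromatic_number by blast
  show "\<exists>G\<^sub>2 :: nat pair_pre_digraph.
    pair_graph G\<^sub>2 \<and> outerplanar G\<^sub>2 \<and> max_degree G\<^sub>2 \<le> 3 \<and> exact_square_chromatic_number G\<^sub>2 = 4"
    using pair_graph_tripod tripod_outerplanar tripod_max_degree tripod_chromatic_number by blast
qed (use pair_graph.subcubic_K4_minor_free_le_4 in blast)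

end
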